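(* Consider the maximum likelihood estimators of the cubic mean-field model, denoted by $\hat\beta_n$ and $\hat h_n$, with $\gamma$ as in the context. If $(\beta,h)\in((0,\infty)\times\mathbb R)\setminus\gamma$, then as $n\to\infty$ $$\sqrt n(\hat\beta_n-\beta)\to N(0,\sigma_\beta),\qquad\sqrt n(\hat h_n-h)\to N(0,\sigma_h)\qquad\text{in law},$$ where $\sigma_\beta$ and $\sigma_h$ are positive constants.
   Context: Let $\beta>0$ and $h\in\mathbb R$ be parameters. For $\omega\in\{1,-1\}^n$ let $\bar\omega_+=|\{i:\omega_i=1\}|/n$. The cubic mean-field model is $\mu_n(\omega)\propto\exp(nf_{\beta,h}(\bar\omega_+))$ on $\{1,-1\}^n$, with $f_{\beta,h}(a)=\beta(2a-1)^3+h(2a-1)^2$. Let $I(a)=-a\log a-(1-a)\log(1-a)$ on $[0,1]$ ($0\log0=0$) and $A=f_{\beta,h}+I$. A maximizer $a$ of $A$ is called 2-regular if $A'(a)=0$ and $A''(a)<0$. The paper recalls from earlier work the following phase diagram: there exists a curve parameterized by a function $g$, $\gamma=\{(\beta,h):h=g(\beta),\beta>0\}$, such that if $(\beta,h)\in((0,\infty)\times\mathbb R)\setminus\gamma$, then $A$ has a unique maximizer $a_*\in(0,1)$, satisfying $a_*\ne1/2$, and $a_*$ is 2-regular; if $(\beta,h)\in\gamma$, then $A$ has two maximizers $1/2=a_-<a_+<1$, which are both 2-regular. MLEs: each parameter is estimated from one sample $\omega\sim\mu_n$ with the other known; $\hat\beta_n$ is the solution $x$ of $\mathbb E_{x,h}[(2\bar\omega_+-1)^3]=(2\bar\omega_+-1)^3$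 and $\hat h_n$ the solution $x$ of $\mathbb E_{\beta,x}[(2\bar\omega_+-1)^2]=(2\bar\omega_+-1)^2$, where $\mathbb E_{\beta,h}$ is expectation under the measure with parameters $(\beta,h)$. $N(0,\sigma)$ is the centered normal law with variance $\sigma$.
   Formalization: The formal theorem also assumes that 1/2 is not a maximizer of A at the given (β,h); the recalled claim that a_*≠1/2 everywhere off γ fails below the curve (e.g. β=1/4, h=0), where the stated limit laws fail. *)

theory Defs
  imports "HOL-Probability.Probability"
begin

definition configs :: "nat \<Rightarrow> (nat \<Rightarrow> real) set" where
  "configs n = PiE {..<n} (\<lambda>_. {1, -1})"

definition plus_fraction :: "nat \<Rightarrow> (nat \<Rightarrow> real) \<Rightarrow> real" where
  "plus_fraction n \<omega> = real (card {i. i < n \<and> \<omega> i = 1}) / real n"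

definition cubic_f :: "real \<Rightarrow> real \<Rightarrow> real \<Rightarrow> real" where
  "cubic_f \<beta> h a = \<beta> * (2 * a - 1) ^ 3 + h * (2 * a - 1) ^ 2"

definition entropy_I :: "real \<Rightarrow> real" where
  "entropy_I a = - a * ln a - (1 - a) * ln (1 - a)"

definition cubic_A :: "real \<Rightarrow> real \<Rightarrow> real \<Rightarrow> real" where
  "cubic_A \<beta> h a = cubic_f \<beta> h a + entropy_I a"

definition partition_fn :: "nat \<Rightarrow> real \<Rightarrow> real \<Rightarrow> real" where
  "partition_fn n \<beta> h = (\<Sum>\<omega>\<in>configs n. exp (real n * cubic_f \<beta> h (plus_fraction n \<omega>)))"

definition cubic_measure :: "nat \<Rightarrow> real \<Rightarrow> real \<Rightarrow> (nat \<Rightarrow> real) measure" where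
  "cubic_measure n \<beta> h = point_measure (configs n)
     (\<lambda>\<omega>. ennreal (exp (real n * cubic_f \<beta> h (plus_fraction n \<omega>)) / partition_fn n \<beta> h))"

definition A_maximizers :: "real \<Rightarrow> real \<Rightarrow> real set" where
  "A_maximizers \<beta> h = {a. is_arg_max (cubic_A \<beta> h) (\<lambda>a. a \<in> {0..1}) a}"

definition two_regular :: "real \<Rightarrow> real \<Rightarrow> real \<Rightarrow> bool" where
  "two_regular \<beta> h a \<longleftrightarrow> a \<in> A_maximizers \<beta> h \<and>
     deriv (cubic_A \<beta> h) a = 0 \<and> deriv (deriv (cubic_A \<beta> h)) a < 0"

definition phase_curve :: "(real \<Rightarrow> real) \<Rightarrow> (real \<times> real) set" where
  "phase_curve g = {(\<beta>, h). \<beta> > 0 \<and> h = g \<beta>}"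

text \<open>The phase diagram that determines the curve. The clause that the unique maximizer off the
  curve differs from 1/2 is deliberately left out: it fails below the curve (for \<open>0 < \<beta> < 1/2\<close> and
  \<open>h \<le> 0\<close> the unique maximizer is 1/2), so no \<open>g\<close> would satisfy it at every off-curve point. It
  has to be imposed at the parameter under consideration, as
  \<open>1/2 \<notin> A_maximizers \<beta> h\<close>.\<close>

definition phase_diagram :: "(real \<Rightarrow> real) \<Rightarrow> bool" where
  "phase_diagram g \<longleftrightarrow>
     (\<forall>(\<beta>, h) \<in> ({0<..} \<times> UNIV) - phase_curve g.
        \<exists>a. 0 < a \<and> a < 1 \<and> A_maximizers \<beta> h = {a} \<and> two_regular \<beta> h a) \<and>
     (\<forall>(\<beta>, h) \<in> phase_curve g.
        \<exists>a. 1/2 < a \<and> a < 1 \<and> A_maximizers \<beta> h = {1/2, a} \<and>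
            two_regular \<beta> h (1/2) \<and> two_regular \<beta> h a)"

text \<open>The likelihood equations need not be solvable for every configuration (for instance when all
  spins equal 1). An estimator is required to solve the equation wherever a solution in the
  parameter space exists, and is unconstrained elsewhere.\<close>

definition beta_equation :: "nat \<Rightarrow> real \<Rightarrow> (nat \<Rightarrow> real) \<Rightarrow> real \<Rightarrow> bool" where
  "beta_equation n h \<omega> x \<longleftrightarrow>
     (LINT \<eta>|cubic_measure n x h. (2 * plus_fraction n \<eta> - 1) ^ 3) = (2 * plus_fraction n \<omega> - 1) ^ 3"

definition h_equation :: "nat \<Rightarrow> real \<Rightarrow> (nat \<Rightarrow> real) \<Rightarrow> real \<Rightarrow> bool" where
  "h_equation n \<beta> \<omega> x \<longleftrightarrow>
     (LINT \<eta>|cubic_measure n \<beta> x. (2 * plus_fraction n \<eta> - 1) ^ 2) = (2 * plus_fraction n \<omega> - 1) ^ 2"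

definition is_beta_MLE :: "real \<Rightarrow> (nat \<Rightarrow> (nat \<Rightarrow> real) \<Rightarrow> real) \<Rightarrow> bool" where
  "is_beta_MLE h T \<longleftrightarrow> (\<forall>n. \<forall>\<omega>\<in>configs n.
     (\<exists>x>0. beta_equation n h \<omega> x) \<longrightarrow> T n \<omega> > 0 \<and> beta_equation n h \<omega> (T n \<omega>))"

definition is_h_MLE :: "real \<Rightarrow> (nat \<Rightarrow> (nat \<Rightarrow> real) \<Rightarrow> real) \<Rightarrow> bool" where
  "is_h_MLE \<beta> T \<longleftrightarrow> (\<forall>n. \<forall>\<omega>\<in>configs n.
     (\<exists>x. h_equation n \<beta> \<omega> x) \<longrightarrow> h_equation n \<beta> \<omega> (T n \<omega>))"

text \<open>The second argument of \<^const>\<open>normal_density\<close> is the standard deviation.\<close>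

definition centered_normal :: "real \<Rightarrow> real measure" where
  "centered_normal v = density lborel (normal_density 0 (sqrt v))"

definition scaled_error_law ::
  "(nat \<Rightarrow> (nat \<Rightarrow> real) \<Rightarrow> real) \<Rightarrow> real \<Rightarrow> real \<Rightarrow> real \<Rightarrow> nat \<Rightarrow> real measure" where
  "scaled_error_law T \<theta> \<beta> h n =
     distr (cubic_measure n \<beta> h) borel (\<lambda>\<omega>. sqrt (real n) * (T n \<omega> - \<theta>))"

end

theory Submission
  imports Defs "HOL-Real_Asymp.Real_Asymp"
begin

text \<open>
  Let \<open>a\<close> be the maximizer, \<open>\<phi>\<close> the statistic (the cube or the square of \<open>2 x - 1\<close>), \<open>x\<close> the fraction of
  plus spins and \<open>X\<^sub>n = sqrt n (\<phi> x - \<phi> a)\<close>. Shifting the parameter by \<open>t / sqrt n\<close> tilts the measure by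
  \<open>exp (t X\<^sub>n)\<close>. Discrete summation by parts gives an approximate Stein identity
  \<open>E\<^sub>t[X\<^sub>n exp (i s X\<^sub>n)] = v (t + i s) E\<^sub>t[exp (i s X\<^sub>n)] + o(1)\<close> with \<open>v = \<phi>'(a)\<^sup>2 / (- A''(a))\<close>, where the error
  is controlled by \<open>sqrt n E\<^sub>t[(x - a)\<^sup>2]\<close>; this tends to \<open>0\<close> since \<open>A\<close> falls off quadratically from \<open>A a\<close>.
  For \<open>t = 0\<close> the identity is a differential equation for the characteristic function and yields
  \<open>X\<^sub>n \<rightarrow> N(0, v)\<close>; for \<open>s = 0\<close> it says that the tilted mean of \<open>X\<^sub>n\<close> tends to \<open>v t\<close>. As the tilted mean is
  increasing in \<open>t\<close>, the scaled error of the estimator is at most \<open>t\<close> iff \<open>X\<^sub>n\<close> is at most the mean at tilt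
  \<open>t\<close>, and the limit law is \<open>N(0, 1 / v)\<close>.
\<close>

section \<open>Inverting a monotone likelihood equation\<close>

lemma measure_std_normal_singleton: "measure std_normal_distribution {x} = 0"
proof -
  have "emeasure std_normal_distribution {x} = 0"
    by (subst emeasure_density) (auto intro!: nn_integral_null_set)
  then show ?thesis by (simp add: measure_def)
qed

lemma isCont_cdf_std_normal: "isCont (cdf std_normal_distribution) x"
proof -
  interpret real_distribution std_normal_distribution by (rule real_dist_normal_dist)
  show ?thesis by (simp add: isCont_cdf measure_std_normal_singleton)
qed

lemma cdf_centered_normal:
  assumes "v > 0"
  shows "cdf (centered_normal v) t = cdf std_normal_distribution (t / sqrt v)"
proof -
  interpret N: real_distribution std_normal_distribution by (rule real_dist_normal_dist)
  have d: "distributed std_normal_distribution lborel (\<lambda>x. x) (normal_density 0 1)"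
    by (auto simp: distributed_def distr_id2 intro!: distr_id2)
  have "distributed std_normal_distribution lborel (\<lambda>x. 0 + sqrt v * x)
     (normal_density (0 + sqrt v * 0) (\<bar>sqrt v\<bar> * 1))"
    using assms by (intro N.normal_density_affine[OF d]) auto
  then have "centered_normal v = distr std_normal_distribution lborel (\<lambda>x. sqrt v * x)"
    using assms by (simp add: distributed_def centered_normal_def)
  then have "cdf (centered_normal v) t = measure std_normal_distribution ((\<lambda>x. sqrt v * x) -` {..t} \<inter> space std_normal_distribution)"
    by (simp add: cdf_def measure_distr)
  also have "(\<lambda>x. sqrt v * x) -` {..t} \<inter> space std_normal_distribution = {..t / sqrt v}"
    using assms by (auto simp: pos_le_divide_eq mult.commute)
  finally show ?thesis by (simp add: cdf_def)
qed

text \<open>Pointwise convergence at the two fixed points \<open>l - d/2\<close> and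
  \<open>l + d/2\<close> suffices: \<open>cdf (M n)\<close> is monotone, so its values there enclose
  the one at \<open>y n\<close>, and continuity of \<open>cdf N\<close> at \<open>l\<close> makes
  the enclosure narrow.\<close>

lemma weak_conv_cdf_moving:
  assumes conv: "weak_conv_m M N" and M: "\<And>n. real_distribution (M n)" and N: "real_distribution N"
    and cont: "\<And>x. isCont (cdf N) x" and y: "y \<longlonglongrightarrow> l"
  shows "(\<lambda>n. cdf (M n) (y n)) \<longlonglongrightarrow> cdf N l"
proof (rule LIMSEQ_I)
  fix r :: real assume r: "r > 0"
  have "\<exists>d>0. \<forall>x. dist x l < d \<longrightarrow> dist (cdf N x) (cdf N l) < r/2"
    using cont[of l] r unfolding continuous_at_eps_delta by (metis half_gt_zero)
  then obtain d where d: "d > 0" "\<And>x. dist x l < d \<Longrightarrow> dist (cdf N x) (cdf N l) < r/2" by auto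
  have lim: "(\<lambda>n. cdf (M n) x) \<longlonglongrightarrow> cdf N x" for x
    using conv cont by (auto simp: weak_conv_m_def weak_conv_def)
  have near: "dist (cdf N (l - d/2)) (cdf N l) < r/2" "dist (cdf N (l + d/2)) (cdf N l) < r/2"
    using d by (auto simp: dist_real_def)
  have "eventually (\<lambda>n. dist (cdf (M n) (l - d/2)) (cdf N (l - d/2)) < r/2) sequentially"
    "eventually (\<lambda>n. dist (cdf (M n) (l + d/2)) (cdf N (l + d/2)) < r/2) sequentially"
    "eventually (\<lambda>n. dist (y n) l < d/2) sequentially"
    using r d(1) by (intro tendstoD lim y; simp)+
  then have "eventually (\<lambda>n. norm (cdf (M n) (y n) - cdf N l) < r) sequentially"
  proof eventually_elim
    case (elim n)
    interpret finite_borel_measure "M n"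
      using M[of n] by (rule real_distribution.finite_borel_measure_M)
    have "cdf (M n) (l - d/2) \<le> cdf (M n) (y n)" "cdf (M n) (y n) \<le> cdf (M n) (l + d/2)"
      using elim(3) by (auto intro!: cdf_nondecreasing simp: dist_real_def abs_if split: if_splits)
    with elim near show ?case unfolding dist_real_def real_norm_def by linarith
  qed
  then show "\<exists>no. \<forall>n\<ge>no. norm (cdf (M n) (y n) - cdf N l) < r"
    by (simp add: eventually_sequentially)
qed

text \<open>If \<open>\<theta> + Y n / sqrt n\<close> solves the likelihood equation and \<open>m n t\<close> is the expectation of the
  statistic \<open>X n\<close> at the parameter \<open>\<theta> + t / sqrt n\<close>, then by monotonicity \<open>Y n \<le> t\<close> means
  \<open>X n \<le> m n t\<close>, so a central limit theorem for \<open>X n\<close> carries over to \<open>Y n\<close>.\<close>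

lemma weak_conv_inverse_estimator:
  fixes M :: "nat \<Rightarrow> 'a measure" and X Y :: "nat \<Rightarrow> 'a \<Rightarrow> real" and m :: "nat \<Rightarrow> real \<Rightarrow> real"
  assumes prob: "\<And>n. prob_space (M n)"
    and X[measurable]: "\<And>n. X n \<in> borel_measurable (M n)"
    and Y[measurable]: "\<And>n. Y n \<in> borel_measurable (M n)"
    and v: "v > 0"
    and conv: "weak_conv_m (\<lambda>n. distr (M n) borel (\<lambda>\<omega>. X n \<omega> / sqrt v)) std_normal_distribution"
    and mlim: "\<And>t. (\<lambda>n. m n t) \<longlonglongrightarrow> v * t"
    and mono: "eventually (\<lambda>n. strict_mono (m n)) sequentially"
    and cont: "\<And>n. continuous_on UNIV (m n)"
    and sol: "\<And>R. R > 0 \<Longrightarrow> eventually (\<lambda>n. \<forall>\<omega>\<in>space (M n). \<forall>s. \<bar>s\<bar> \<le> R \<longrightarrow> m n s = X n \<omega> \<longrightarrow> m n (Y n \<omega>) = X n \<omega>) sequentially"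
  shows "weak_conv_m (\<lambda>n. distr (M n) borel (Y n)) (centered_normal (1 / v))"
proof -
  let ?N = std_normal_distribution
  let ?D = "\<lambda>n. distr (M n) borel (\<lambda>\<omega>. X n \<omega> / sqrt v)"
  interpret N: real_distribution ?N by (rule real_dist_normal_dist)
  have D: "real_distribution (?D n)" for n
    by (rule prob_space.real_distribution_distr[OF prob]) measurable
  have sv: "sqrt v > 0" "v / sqrt v = sqrt v" using v by (auto simp: real_div_sqrt)
  have lim: "(\<lambda>n. cdf (?D n) (m n t / sqrt v)) \<longlonglongrightarrow> cdf ?N (sqrt v * t)" for t
  proof (rule weak_conv_cdf_moving[OF conv D real_dist_normal_dist isCont_cdf_std_normal])
    have "(\<lambda>n. m n t / sqrt v) \<longlonglongrightarrow> v * t / sqrt v"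
      using sv by (intro tendsto_divide mlim tendsto_const) auto
    then show "(\<lambda>n. m n t / sqrt v) \<longlonglongrightarrow> sqrt v * t" using sv(2) by (metis times_divide_eq_left)
  qed
  have cdfD: "cdf (?D n) (x / sqrt v) = measure (M n) {\<omega>\<in>space (M n). X n \<omega> \<le> x}" for n x
    unfolding cdf_def using sv by (subst measure_distr) (auto simp: divide_le_cancel intro!: arg_cong[where f="measure (M n)"])
  have cdfY: "cdf (distr (M n) borel (Y n)) x = measure (M n) {\<omega>\<in>space (M n). Y n \<omega> \<le> x}" for n x
    unfolding cdf_def by (subst measure_distr) (auto intro!: arg_cong[where f="measure (M n)"])
  have main: "(\<lambda>n. cdf (distr (M n) borel (Y n)) t) \<longlonglongrightarrow> cdf ?N (sqrt v * t)" for t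
  proof (rule LIMSEQ_I)
    fix r :: real assume r: "r > 0"
    \<comment> \<open>\<open>sol\<close> only speaks about tilts up to \<open>R\<close>. Hence
      \<open>R\<close> is taken so large that the limiting probability of \<open>X n\<close> leaving
      \<open>[m n (-R), m n R]\<close> is below \<open>r / 2\<close>.\<close>
    have l1: "((\<lambda>R. cdf ?N (sqrt v * - R)) \<longlongrightarrow> 0) at_top"
      using sv by (intro filterlim_compose[OF N.cdf_lim_at_bot] filterlim_tendsto_pos_mult_at_bot[OF tendsto_const]
        filterlim_uminus_at_bot_at_top) auto
    have l2: "((\<lambda>R. cdf ?N (sqrt v * R)) \<longlongrightarrow> 1) at_top"
      using sv by (intro filterlim_compose[OF N.cdf_lim_at_top_prob] filterlim_tendsto_pos_mult_at_top[OF tendsto_const] filterlim_ident) auto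
    have "((\<lambda>R. cdf ?N (sqrt v * - R) + (1 - cdf ?N (sqrt v * R))) \<longlongrightarrow> 0 + (1 - 1)) at_top"
      by (intro tendsto_intros l1 l2)
    then have "eventually (\<lambda>R. cdf ?N (sqrt v * - R) + (1 - cdf ?N (sqrt v * R)) < r / 2) at_top"
      using r by (intro order_tendstoD) auto
    with eventually_gt_at_top[of "\<bar>t\<bar>"]
    have "eventually (\<lambda>R. cdf ?N (sqrt v * - R) + (1 - cdf ?N (sqrt v * R)) < r / 2 \<and> R > \<bar>t\<bar>) at_top"
      by eventually_elim auto
    then obtain R where R: "cdf ?N (sqrt v * - R) + (1 - cdf ?N (sqrt v * R)) < r / 2" "R > \<bar>t\<bar>"
      by (auto simp: eventually_at_top_linorder)
    have R0: "R > 0" using R(2) by linarith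
    have "(\<lambda>n. cdf (?D n) (m n (-R) / sqrt v) + (1 - cdf (?D n) (m n R / sqrt v)))
       \<longlonglongrightarrow> cdf ?N (sqrt v * - R) + (1 - cdf ?N (sqrt v * R))"
      by (intro tendsto_intros lim)
    then have e1: "eventually (\<lambda>n. cdf (?D n) (m n (-R) / sqrt v) + (1 - cdf (?D n) (m n R / sqrt v)) < r/2) sequentially"
      using R(1) by (rule order_tendstoD)
    have e2: "eventually (\<lambda>n. dist (cdf (?D n) (m n t / sqrt v)) (cdf ?N (sqrt v * t)) < r / 2) sequentially"
      using r by (intro tendstoD lim) auto
    from e1 e2 mono sol[OF R0]
    have "eventually (\<lambda>n. norm (cdf (distr (M n) borel (Y n)) t - cdf ?N (sqrt v * t)) < r) sequentially"
    proof eventually_elim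
      case (elim n)
      interpret prob_space "M n" by (rule prob)
      let ?E = "{\<omega>\<in>space (M n). X n \<omega> \<le> m n t}" and ?F = "{\<omega>\<in>space (M n). Y n \<omega> \<le> t}"
      let ?A = "{\<omega>\<in>space (M n). X n \<omega> \<le> m n (-R)}" and ?B = "{\<omega>\<in>space (M n). \<not> X n \<omega> \<le> m n R}"
      \<comment> \<open>Off the two tail events the intermediate value theorem yields a root
        \<open>s\<close> in \<open>[-R, R]\<close>. Then \<open>Y n \<omega>\<close> is a root too,
        and strict monotonicity compares it with \<open>t\<close>.\<close>
      have key: "X n \<omega> \<le> m n t \<longleftrightarrow> Y n \<omega> \<le> t" if w: "\<omega> \<in> space (M n)" "\<omega> \<notin> ?A" "\<omega> \<notin> ?B" for \<omega>
      proof -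
        have "\<exists>s\<ge>-R. s \<le> R \<and> m n s = X n \<omega>"
          using w R0 by (intro IVT' continuous_on_subset[OF cont]) auto
        then obtain s where "\<bar>s\<bar> \<le> R" "m n s = X n \<omega>" by (auto simp: abs_le_iff) (metis minus_le_iff)
        with elim(4) w(1) have "m n (Y n \<omega>) = X n \<omega>" by blast
        then show ?thesis using strict_mono_less_eq[OF elim(3), of "Y n \<omega>" t] by simp
      qed
      have B: "prob ?B = 1 - cdf (?D n) (m n R / sqrt v)"
        unfolding cdfD by (rule prob_neg) measurable
      have AB: "prob (?A \<union> ?B) \<le> prob ?A + prob ?B" by (rule measure_Un_le) measurable
      have "prob ?E \<le> prob (?F \<union> (?A \<union> ?B))"
        using key by (intro finite_measure_mono) (blast, measurable)
      also have "\<dots> \<le> prob ?F + prob (?A \<union> ?B)" by (rule measure_Un_le) measurable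
      finally have 1: "prob ?E \<le> prob ?F + (prob ?A + prob ?B)" using AB by linarith
      have "prob ?F \<le> prob (?E \<union> (?A \<union> ?B))"
        using key by (intro finite_measure_mono) (blast, measurable)
      also have "\<dots> \<le> prob ?E + prob (?A \<union> ?B)" by (rule measure_Un_le) measurable
      finally have 2: "prob ?F \<le> prob ?E + (prob ?A + prob ?B)" using AB by linarith
      show ?case using elim(1,2) 1 2 unfolding cdfY B cdfD[symmetric] dist_real_def real_norm_def by linarith
    qed
    then show "\<exists>no. \<forall>n\<ge>no. norm (cdf (distr (M n) borel (Y n)) t - cdf ?N (sqrt v * t)) < r"
      by (simp add: eventually_sequentially)
  qed
  have "cdf (centered_normal (1 / v)) t = cdf ?N (sqrt v * t)" for t
    using v by (subst cdf_centered_normal) (auto simp: real_sqrt_divide mult.commute)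
  with main show ?thesis by (simp add: weak_conv_m_def weak_conv_def)
qed

section \<open>Concentration for tilted binomial weights\<close>

text \<open>A single term of the binomial distribution with success probability \<open>k / n\<close>
  is at most 1, and its two powers multiply to the exponential of minus \<open>n\<close> times the
  entropy.\<close>

lemma binomial_le_exp_entropy:
  assumes "k \<le> n" "n > 0"
  shows "real (n choose k) \<le> exp (real n * entropy_I (real k / real n))"
proof -
  define x where "x = real k / real n"
  have x: "0 \<le> x" "x \<le> 1" using assms by (auto simp: x_def)
  have "Bernstein n k x \<le> (\<Sum>j\<le>n. Bernstein n j x)"
    using assms x by (intro member_le_sum Bernstein_nonneg) auto
  then have "Bernstein n k x \<le> 1" by simp
  then have le1: "real (n choose k) * (x ^ k * (1 - x) ^ (n - k)) \<le> 1"
    by (simp add: Bernstein_def mult.assoc)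
  have "x ^ k * (1 - x) ^ (n - k) = exp (- (real n * entropy_I x))"
  proof -
    \<comment> \<open>At the endpoints both sides equal 1, by \<open>0 ^ 0 = 1\<close> and
      \<open>0 * ln 0 = 0\<close>.\<close>
    consider "k = 0" | "k = n" "k > 0" | "0 < k" "k < n" using assms by linarith
    then show ?thesis
    proof cases
      case 3
      then have x': "0 < x" "x < 1" by (auto simp: x_def)
      have e: "- (real n * entropy_I x) = real k * ln x + real (n - k) * ln (1 - x)"
        using 3 by (auto simp: entropy_I_def x_def of_nat_diff field_simps)
      show ?thesis unfolding e exp_add exp_of_nat_mult using x' by simp
    qed (use assms in \<open>auto simp: x_def entropy_I_def\<close>)
  qed
  with le1 have "real (n choose k) / exp (real n * entropy_I x) \<le> 1" by (simp add: exp_minus divide_inverse)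
  then show ?thesis unfolding x_def by (simp add: pos_divide_le_eq)
qed

lemma sum_Bernstein_centered: "(\<Sum>k\<le>n. Bernstein n k x * (real k - real n * x)) = 0"
proof -
  have "(\<Sum>k\<le>n. Bernstein n k x * (real k - real n * x)) =
    (\<Sum>k\<le>n. real k * Bernstein n k x) - real n * x * (\<Sum>k\<le>n. Bernstein n k x)"
    by (simp only: sum_distrib_left sum_subtractf[symmetric]) (intro sum.cong, auto simp: algebra_simps)
  then show ?thesis by simp
qed

lemma sum_Bernstein_variance:
  "(\<Sum>k\<le>n. Bernstein n k x * (real k - real n * x)\<^sup>2) = real n * x * (1 - x)"
proof -
  have "(\<Sum>k\<le>n. Bernstein n k x * (real k - real n * x)\<^sup>2) =
    (\<Sum>k\<le>n. real k * (real k - 1) * Bernstein n k x) + (1 - 2 * real n * x) * (\<Sum>k\<le>n. real k * Bernstein n k x)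
     + (real n * x)\<^sup>2 * (\<Sum>k\<le>n. Bernstein n k x)"
    by (simp only: sum_distrib_left sum.distrib[symmetric])
       (intro sum.cong, auto simp: algebra_simps power2_eq_square)
  then show ?thesis unfolding sum_kk_Bernstein sum_k_Bernstein sum_Bernstein
    by (simp add: algebra_simps power2_eq_square)
qed

lemma cubic_remainder_le:
  fixes y :: real
  assumes "\<bar>y\<bar> \<le> 1"
  shows "\<bar>p * y\<^sup>2 + q * y ^ 3\<bar> \<le> (\<bar>p\<bar> + \<bar>q\<bar>) * y\<^sup>2"
proof -
  have "\<bar>y ^ 3\<bar> = \<bar>y\<bar> * y\<^sup>2" by (simp add: power3_eq_cube power2_eq_square abs_mult)
  also have "\<dots> \<le> 1 * y\<^sup>2" using assms by (intro mult_right_mono) auto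
  finally have "\<bar>q\<bar> * \<bar>y ^ 3\<bar> \<le> \<bar>q\<bar> * y\<^sup>2" by (intro mult_left_mono) auto
  moreover have "\<bar>p * y\<^sup>2 + q * y ^ 3\<bar> \<le> \<bar>p\<bar> * y\<^sup>2 + \<bar>q\<bar> * \<bar>y ^ 3\<bar>"
    using abs_triangle_ineq[of "p * y\<^sup>2" "q * y ^ 3"] by (simp add: abs_mult)
  ultimately show ?thesis by (simp add: algebra_simps)
qed

text \<open>\<open>c1, c2, c3\<close> stand for the Taylor coefficients of the potential at the
  maximizer \<open>a\<close>, and \<open>d1, d2, d3\<close> for those of the statistic; both are
  polynomials of degree at most three, so the expansions are exact. With \<open>A\<close> the
  potential plus the entropy, the conditions on \<open>c1\<close> and \<open>c2\<close> say
  \<open>A'(a) = 0\<close> and \<open>A''(a) < 0\<close>, and \<open>dom\<close> is global quadratic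
  decay.\<close>

locale cubic_laplace =
  fixes a c1 c2 c3 d1 d2 d3 c :: real
  assumes a: "0 < a" "a < 1"
    and c1: "c1 = ln a - ln (1 - a)"
    and c2: "2 * c2 < 1 / (a * (1 - a))"
    and c: "c > 0"
    and dom: "\<And>x. 0 \<le> x \<Longrightarrow> x \<le> 1 \<Longrightarrow>
      c1 * (x - a) + c2 * (x - a)\<^sup>2 + c3 * (x - a) ^ 3 + entropy_I x \<le> entropy_I a - c * (x - a)\<^sup>2"
begin

definition P :: "real \<Rightarrow> real" where "P y = c1 * y + c2 * y\<^sup>2 + c3 * y ^ 3"
definition Q :: "real \<Rightarrow> real" where "Q y = d1 * y + d2 * y\<^sup>2 + d3 * y ^ 3"

definition dev :: "nat \<Rightarrow> nat \<Rightarrow> real" where "dev n k = real k / real n - a"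
definition X :: "nat \<Rightarrow> nat \<Rightarrow> real" where "X n k = sqrt (real n) * Q (dev n k)"

text \<open>The weight of having \<open>k\<close> plus spins under tilt \<open>t\<close>, without
  the factor that does not depend on \<open>k\<close>; that factor cancels in every quotient by
  \<open>Z\<close>.\<close>

definition W :: "nat \<Rightarrow> real \<Rightarrow> nat \<Rightarrow> real" where
  "W n t k = real (n choose k) * exp (real n * P (dev n k) + t * X n k)"
definition Z :: "nat \<Rightarrow> real \<Rightarrow> real" where "Z n t = (\<Sum>k\<le>n. W n t k)"
text \<open>Complex tilts put both limits under one Stein bound: real \<open>z\<close> gives the
  tilted mean, imaginary \<open>z\<close> the characteristic function.\<close>

definition V :: "nat \<Rightarrow> complex \<Rightarrow> nat \<Rightarrow> complex" where
  "V n z k = of_nat (n choose k) * exp (of_real (real n * P (dev n k)) + z * of_real (X n k))"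

text \<open>This is \<open>- A''(a)\<close>, the inverse of the variance to be expected for
  \<open>sqrt n * dev\<close>. As in the delta method, \<open>v\<close> multiplies that variance by
  the squared slope \<open>d1\<close> of the statistic.\<close>

definition kappa :: real where "kappa = 1 / (a * (1 - a)) - 2 * c2"
definition v :: real where "v = d1\<^sup>2 / kappa"

definition spread :: "nat \<Rightarrow> real \<Rightarrow> real" where
  "spread n t = (\<Sum>k\<le>n. W n t k * (dev n k)\<^sup>2)"

lemma kappa_pos: "kappa > 0" using c2 by (simp add: kappa_def)

lemma W_nonneg: "W n t k \<ge> 0" by (simp add: W_def)

lemma Z_pos: "Z n t > 0"
  unfolding Z_def by (intro sum_pos) (auto simp: W_def)

lemma norm_V: "norm (V n z k) = W n (Re z) k"
  by (simp add: V_def W_def norm_mult)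

lemma V_of_real: "V n (of_real t) k = of_real (W n t k)"
  by (simp add: V_def W_def exp_of_real[symmetric])

lemma abs_dev_le: "k \<le> n \<Longrightarrow> n > 0 \<Longrightarrow> \<bar>dev n k\<bar> \<le> 1"
proof -
  assume "k \<le> n" "n > 0"
  then have "0 \<le> real k / real n" "real k / real n \<le> 1" by auto
  then show ?thesis using a unfolding dev_def by linarith
qed

lemma abs_Q_le: "\<bar>y\<bar> \<le> 1 \<Longrightarrow> \<bar>Q y\<bar> \<le> (\<bar>d1\<bar> + \<bar>d2\<bar> + \<bar>d3\<bar>) * \<bar>y\<bar>"
proof -
  assume y: "\<bar>y\<bar> \<le> 1"
  have "\<bar>y\<bar> * \<bar>y\<bar> \<le> 1 * \<bar>y\<bar>" using y by (intro mult_right_mono) auto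
  then have "y\<^sup>2 \<le> \<bar>y\<bar>" by (simp add: power2_eq_square)
  then have "(\<bar>d2\<bar> + \<bar>d3\<bar>) * y\<^sup>2 \<le> (\<bar>d2\<bar> + \<bar>d3\<bar>) * \<bar>y\<bar>" by (intro mult_left_mono) auto
  moreover have "\<bar>Q y\<bar> \<le> \<bar>d1 * y\<bar> + \<bar>d2 * y\<^sup>2 + d3 * y ^ 3\<bar>" unfolding Q_def by linarith
  ultimately show ?thesis using cubic_remainder_le[OF y, of d2 d3] by (simp add: algebra_simps abs_mult)
qed

text \<open>The entropy bound on the binomial coefficient and \<open>dom\<close> combine to Gaussian
  decay in \<open>sqrt n * \<bar>dev n k\<bar>\<close>; the tilt costs only a linear term in the
  same variable.\<close>

lemma W_upper:
  assumes "k \<le> n" "n > 0"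
  shows "W n t k \<le> exp (real n * entropy_I a) *
    exp (- c * (sqrt n * \<bar>dev n k\<bar>)\<^sup>2 + \<bar>t\<bar> * (\<bar>d1\<bar> + \<bar>d2\<bar> + \<bar>d3\<bar>) * (sqrt n * \<bar>dev n k\<bar>))"
proof -
  define x where "x = real k / real n"
  define y where "y = dev n k"
  have x: "0 \<le> x" "x \<le> 1" "y = x - a" using assms by (auto simp: x_def y_def dev_def)
  have y: "\<bar>y\<bar> \<le> 1" unfolding y_def using assms by (rule abs_dev_le)
  have "t * X n k \<le> \<bar>t\<bar> * \<bar>X n k\<bar>" using abs_le_D1[OF order_refl, of "t * X n k"] by (simp add: abs_mult)
  also have "\<dots> \<le> \<bar>t\<bar> * (sqrt n * ((\<bar>d1\<bar> + \<bar>d2\<bar> + \<bar>d3\<bar>) * \<bar>y\<bar>))"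
    unfolding X_def abs_mult y_def[symmetric] using abs_Q_le[OF y] by (intro mult_left_mono mult_mono) auto
  finally have t: "t * X n k \<le> \<bar>t\<bar> * (\<bar>d1\<bar> + \<bar>d2\<bar> + \<bar>d3\<bar>) * (sqrt n * \<bar>y\<bar>)" by (simp add: mult_ac)
  have "P y + entropy_I x \<le> entropy_I a - c * y\<^sup>2" unfolding P_def x(3) using dom[OF x(1,2)] by simp
  then have "real n * (P y + entropy_I x) \<le> real n * (entropy_I a - c * y\<^sup>2)" by (intro mult_left_mono) auto
  with t have e: "real n * entropy_I x + (real n * P y + t * X n k) \<le>
     real n * entropy_I a + (- c * (sqrt n * \<bar>y\<bar>)\<^sup>2 + \<bar>t\<bar> * (\<bar>d1\<bar> + \<bar>d2\<bar> + \<bar>d3\<bar>) * (sqrt n * \<bar>y\<bar>))"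
    by (simp add: algebra_simps power_mult_distrib)
  have "W n t k \<le> exp (real n * entropy_I x) * exp (real n * P y + t * X n k)"
    unfolding W_def y_def x_def using binomial_le_exp_entropy[OF assms] by (intro mult_right_mono) auto
  also have "\<dots> \<le> exp (real n * entropy_I a) *
    exp (- c * (sqrt n * \<bar>y\<bar>)\<^sup>2 + \<bar>t\<bar> * (\<bar>d1\<bar> + \<bar>d2\<bar> + \<bar>d3\<bar>) * (sqrt n * \<bar>y\<bar>))"
    unfolding exp_add[symmetric] using e by simp
  finally show ?thesis unfolding y_def .
qed

text \<open>Since \<open>c1\<close> is the log-odds of \<open>a\<close>, the linear part of the
  exponent turns the binomial coefficients into the binomial distribution with parameter
  \<open>a\<close>.\<close>

lemma W_Bernstein:
  assumes "k \<le> n" "n > 0"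
  shows "W n t k = exp (real n * entropy_I a) *
    (Bernstein n k a * exp (real n * (P (dev n k) - c1 * dev n k) + t * X n k))"
proof -
  have "a ^ k * (1 - a) ^ (n - k) = exp (real k * ln a + real (n - k) * ln (1 - a))"
    unfolding exp_add exp_of_nat_mult using a by simp
  moreover have "real n * entropy_I a + (real k * ln a + real (n - k) * ln (1 - a)) = real n * (c1 * dev n k)"
    using assms by (simp add: entropy_I_def c1 dev_def of_nat_diff field_simps)
  ultimately have "exp (real n * entropy_I a) * (a ^ k * (1 - a) ^ (n - k)) = exp (real n * (c1 * dev n k))"
    by (simp add: exp_add[symmetric])
  then have "exp (real n * entropy_I a) * (Bernstein n k a * exp (real n * (P (dev n k) - c1 * dev n k) + t * X n k))
    = real (n choose k) * (exp (real n * (c1 * dev n k)) * exp (real n * (P (dev n k) - c1 * dev n k) + t * X n k))"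
    by (simp add: Bernstein_def mult_ac)
  then show ?thesis by (simp add: W_def exp_add[symmetric] algebra_simps)
qed

text \<open>Jensen's inequality for the binomial distribution with parameter \<open>a\<close>; the linear part of the
  exponent has mean zero.\<close>

lemma Z_lower:
  assumes "n > 0"
  shows "exp (real n * entropy_I a) * exp (- ((\<bar>c2\<bar> + \<bar>c3\<bar> + \<bar>t\<bar> * (\<bar>d2\<bar> + \<bar>d3\<bar>)) * a * (1 - a))) \<le> Z n t"
proof -
  define K' where "K' = \<bar>c2\<bar> + \<bar>c3\<bar> + \<bar>t\<bar> * (\<bar>d2\<bar> + \<bar>d3\<bar>)"
  define K where "K = K' * a * (1 - a)"
  have n1: "sqrt n \<le> n" "sqrt n > 0"
  proof -
    have "sqrt n * 1 \<le> sqrt n * sqrt n" using assms by (intro mult_left_mono) auto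
    then show "sqrt n \<le> n" by simp
  qed (use assms in auto)
  \<comment> \<open>The tangent inequality for \<open>exp\<close> at \<open>-K\<close>. The exponent
    is first bounded below by a centred linear term minus
    \<open>(K' / n) * (k - n * a)\<^sup>2\<close>. The binomial mean of that bound is
    \<open>-K\<close>, so averaging leaves exactly \<open>exp (- K)\<close>.\<close>
  have low: "exp (- K) * (1 + K + (t * d1 / sqrt n) * (real k - n * a) - (K' / n) * (real k - n * a)\<^sup>2)
     \<le> exp (real n * (P (dev n k) - c1 * dev n k) + t * X n k)" if "k \<le> n" for k
  proof -
    let ?y = "dev n k"
    have y: "\<bar>?y\<bar> \<le> 1" using that assms by (rule abs_dev_le)
    have r1: "- ((\<bar>c2\<bar> + \<bar>c3\<bar>) * ?y\<^sup>2) \<le> P ?y - c1 * ?y"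
      using cubic_remainder_le[OF y, of c2 c3] unfolding P_def by linarith
    have "t * (X n k - sqrt n * d1 * ?y) = sqrt n * (t * (d2 * ?y\<^sup>2 + d3 * ?y ^ 3))"
      by (simp add: X_def Q_def algebra_simps)
    also have "\<dots> \<ge> sqrt n * (- (\<bar>t\<bar> * ((\<bar>d2\<bar> + \<bar>d3\<bar>) * ?y\<^sup>2)))"
    proof (intro mult_left_mono)
      have "\<bar>t * (d2 * ?y\<^sup>2 + d3 * ?y ^ 3)\<bar> \<le> \<bar>t\<bar> * ((\<bar>d2\<bar> + \<bar>d3\<bar>) * ?y\<^sup>2)"
        unfolding abs_mult[of t] using cubic_remainder_le[OF y] by (intro mult_left_mono) auto
      then show "- (\<bar>t\<bar> * ((\<bar>d2\<bar> + \<bar>d3\<bar>) * ?y\<^sup>2)) \<le> t * (d2 * ?y\<^sup>2 + d3 * ?y ^ 3)" by linarith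
    qed auto
    moreover have "sqrt n * (\<bar>t\<bar> * ((\<bar>d2\<bar> + \<bar>d3\<bar>) * ?y\<^sup>2)) \<le> n * (\<bar>t\<bar> * ((\<bar>d2\<bar> + \<bar>d3\<bar>) * ?y\<^sup>2))"
      using n1 by (intro mult_right_mono) auto
    ultimately have r2: "t * (X n k - sqrt n * d1 * ?y) \<ge> - (n * (\<bar>t\<bar> * ((\<bar>d2\<bar> + \<bar>d3\<bar>) * ?y\<^sup>2)))"
      by linarith
    have r3: "real n * (- ((\<bar>c2\<bar> + \<bar>c3\<bar>) * ?y\<^sup>2)) \<le> real n * (P ?y - c1 * ?y)"
      using r1 by (intro mult_left_mono) auto
    have ny: "real k - n * a = n * ?y" using assms by (simp add: dev_def field_simps)
    have e1: "(t * d1 / sqrt n) * (real k - n * a) = t * (sqrt n * d1 * ?y)"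
    proof -
      have "n / sqrt n = sqrt n" using assms by (simp add: real_div_sqrt)
      then show ?thesis unfolding ny by (metis (no_types, lifting) mult.assoc mult.commute times_divide_eq_left)
    qed
    have e2: "(K' / n) * (real k - n * a)\<^sup>2 = n * (K' * ?y\<^sup>2)" unfolding ny using assms by (simp add: power2_eq_square)
    have "(t * d1 / sqrt n) * (real k - n * a) - (K' / n) * (real k - n * a)\<^sup>2
      \<le> real n * (P ?y - c1 * ?y) + t * X n k"
      unfolding e1 e2 using r2 r3 by (simp add: K'_def algebra_simps)
    moreover have "1 + (K + u) \<le> exp (K + u)" for u by (rule exp_ge_add_one_self)
    then have "exp (-K) * (1 + (K + u)) \<le> exp (-K) * exp (K + u)" for u by (intro mult_left_mono) auto
    then have "exp (-K) * (1 + K + u) \<le> exp u" for u by (simp add: exp_add[symmetric] add.assoc)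
    ultimately show ?thesis by (smt (verit) exp_le_cancel_iff)
  qed
  have alg: "exp (-K) * ((1 + K) * (\<Sum>k\<le>n. Bernstein n k a)
     + p * (\<Sum>k\<le>n. Bernstein n k a * (real k - n * a))
     - q * (\<Sum>k\<le>n. Bernstein n k a * (real k - n * a)\<^sup>2)) =
     (\<Sum>k\<le>n. Bernstein n k a * (exp (- K) * (1 + K + p * (real k - n * a) - q * (real k - n * a)\<^sup>2)))" for p q
    by (simp only: sum_distrib_left sum.distrib[symmetric] sum_subtractf[symmetric])
       (intro sum.cong, auto simp: algebra_simps)
  have "exp (- K) = exp (-K) * ((1 + K) * (\<Sum>k\<le>n. Bernstein n k a)
     + (t * d1 / sqrt n) * (\<Sum>k\<le>n. Bernstein n k a * (real k - n * a))
     - (K' / n) * (\<Sum>k\<le>n. Bernstein n k a * (real k - n * a)\<^sup>2))"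
    unfolding sum_Bernstein_centered sum_Bernstein_variance sum_Bernstein using assms by (simp add: K_def)
  also have "\<dots> = (\<Sum>k\<le>n. Bernstein n k a * (exp (- K) * (1 + K + (t * d1 / sqrt n) * (real k - n * a) - (K' / n) * (real k - n * a)\<^sup>2)))"
    by (rule alg)
  also have "\<dots> \<le> (\<Sum>k\<le>n. Bernstein n k a * exp (real n * (P (dev n k) - c1 * dev n k) + t * X n k))"
    using a by (intro sum_mono mult_left_mono low Bernstein_nonneg) auto
  finally have "exp (real n * entropy_I a) * exp (-K) \<le>
    exp (real n * entropy_I a) * (\<Sum>k\<le>n. Bernstein n k a * exp (real n * (P (dev n k) - c1 * dev n k) + t * X n k))"
    by (intro mult_left_mono) auto
  also have "\<dots> = Z n t" unfolding Z_def sum_distrib_left using assms by (intro sum.cong W_Bernstein[symmetric]) auto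
  finally show ?thesis by (simp add: K_def K'_def)
qed

text \<open>Terms with squared deviation at most \<open>\<delta>\<close> contribute at most
  \<open>\<delta> * Z n t\<close>. There are at most \<open>n + 1\<close> others, and
  \<open>W_upper\<close> with \<open>Z_lower\<close> bounds each by
  \<open>exp (C - b * (n * \<delta>))\<close> relative to \<open>Z n t\<close>.\<close>

lemma spread_tendsto: "(\<lambda>n. sqrt n * spread n t / Z n t) \<longlonglongrightarrow> 0"
proof -
  define K where "K = (\<bar>c2\<bar> + \<bar>c3\<bar> + \<bar>t\<bar> * (\<bar>d2\<bar> + \<bar>d3\<bar>)) * a * (1 - a)"
  define B where "B = \<bar>t\<bar> * (\<bar>d1\<bar> + \<bar>d2\<bar> + \<bar>d3\<bar>)"
  define C where "C = B\<^sup>2 / (2 * c) + K"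
  define b where "b = c / 2"
  have b: "b > 0" using c by (simp add: b_def)
  have B: "B \<ge> 0" by (simp add: B_def)
  \<comment> \<open>Half of the decay rate \<open>c\<close> absorbs the linear tilt term by
    completing the square.\<close>
  have quad: "- c * u\<^sup>2 + B * u \<le> - b * u\<^sup>2 + B\<^sup>2 / (2 * c)" for u
  proof -
    have "0 \<le> (c * u - B)\<^sup>2 / (2 * c)" using c by simp
    also have "(c * u - B)\<^sup>2 / (2 * c) = b * u\<^sup>2 - B * u + B\<^sup>2 / (2 * c)"
      using c by (simp add: b_def field_simps power2_eq_square)
    finally show ?thesis by (simp add: b_def)
  qed
  have upper: "spread n t / Z n t \<le> \<delta> + (real n + 1) * exp (C - b * (n * \<delta>))" if n: "n > 0" and d: "\<delta> \<ge> 0" for n \<delta>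
  proof -
    let ?T = "exp (real n * entropy_I a) * exp (B\<^sup>2 / (2 * c) - b * (n * \<delta>))"
    have "W n t k * (dev n k)\<^sup>2 \<le> \<delta> * W n t k + ?T" if k: "k \<le> n" for k
    proof (cases "(dev n k)\<^sup>2 \<le> \<delta>")
      case True
      then have "W n t k * (dev n k)\<^sup>2 \<le> W n t k * \<delta>" by (intro mult_left_mono W_nonneg)
      also have "\<dots> \<le> \<delta> * W n t k + ?T" by (simp add: mult.commute)
      finally show ?thesis .
    next
      case False
      have "(dev n k)\<^sup>2 \<le> 1" using abs_dev_le[OF k n] by (simp add: abs_square_le_1)
      then have "W n t k * (dev n k)\<^sup>2 \<le> W n t k * 1" by (intro mult_left_mono W_nonneg)
      also have "\<dots> \<le> exp (real n * entropy_I a) * exp (- c * (sqrt n * \<bar>dev n k\<bar>)\<^sup>2 + B * (sqrt n * \<bar>dev n k\<bar>))"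
        using W_upper[OF k n, of t] by (simp add: B_def)
      also have "\<dots> \<le> ?T"
      proof -
        have "(sqrt n * \<bar>dev n k\<bar>)\<^sup>2 = n * (dev n k)\<^sup>2" by (simp add: power_mult_distrib)
        then have "b * (n * \<delta>) \<le> b * (sqrt n * \<bar>dev n k\<bar>)\<^sup>2" using False b n by simp
        then have "- c * (sqrt n * \<bar>dev n k\<bar>)\<^sup>2 + B * (sqrt n * \<bar>dev n k\<bar>) \<le> B\<^sup>2 / (2 * c) - b * (n * \<delta>)"
          using quad[of "sqrt n * \<bar>dev n k\<bar>"] by linarith
        then show ?thesis by (intro mult_left_mono) (simp_all only: exp_le_cancel_iff exp_ge_zero)
      qed
      also have "\<dots> \<le> \<delta> * W n t k + ?T" using d W_nonneg by simp
      finally show ?thesis .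
    qed
    then have "spread n t \<le> (\<Sum>k\<le>n. \<delta> * W n t k + ?T)" unfolding spread_def by (intro sum_mono) auto
    also have "\<dots> = \<delta> * Z n t + (real n + 1) * ?T" by (simp add: sum.distrib sum_distrib_left Z_def)
    also have "?T \<le> exp (C - b * (n * \<delta>)) * Z n t"
    proof -
      have "?T = exp (C - b * (n * \<delta>)) * (exp (real n * entropy_I a) * exp (- K))"
        by (simp add: exp_add[symmetric] C_def)
      also have "\<dots> \<le> exp (C - b * (n * \<delta>)) * Z n t"
        unfolding K_def using Z_lower[OF n, of t] by (intro mult_left_mono) auto
      finally show ?thesis .
    qed
    finally have "spread n t \<le> \<delta> * Z n t + (real n + 1) * (exp (C - b * (n * \<delta>)) * Z n t)"
      by (simp add: mult_left_mono)
    then show ?thesis using Z_pos[of n t] by (simp add: divide_le_eq algebra_simps)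
  qed
  show ?thesis
  proof (rule tendsto_sandwich)
    \<comment> \<open>The cutoff \<open>\<delta> = n powr (-3/5)\<close> has to be \<open>o(1 / sqrt n)\<close> while \<open>n * \<delta>\<close> beats \<open>ln n\<close>.\<close>
    show "eventually (\<lambda>n. 0 \<le> sqrt n * spread n t / Z n t) sequentially"
      using Z_pos by (intro always_eventually allI divide_nonneg_pos mult_nonneg_nonneg) (auto simp: spread_def intro!: sum_nonneg mult_nonneg_nonneg W_nonneg)
    show "eventually (\<lambda>n. sqrt n * spread n t / Z n t \<le>
      sqrt n * (real n powr (-3/5) + (real n + 1) * exp (C - b * (n * real n powr (-3/5))))) sequentially"
      using eventually_gt_at_top[of 0]
    proof eventually_elim
      case (elim n)
      show ?case unfolding times_divide_eq_right[symmetric] using elim by (intro mult_left_mono upper) auto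
    qed
    show "(\<lambda>n. sqrt (real n) * (real n powr (-3/5) + (real n + 1) * exp (C - b * (real n * real n powr (-3/5))))) \<longlonglongrightarrow> 0"
      using b by real_asymp
  qed auto
qed

section \<open>Approximate Stein identity\<close>

definition drift :: "real \<Rightarrow> real \<Rightarrow> complex \<Rightarrow> complex" where
  "drift y e z = of_real (1 - a - y) *
     exp (of_real (c1 + 2 * c2 * y + c2 * e\<^sup>2 + c3 * (3 * y\<^sup>2 + 3 * y * e\<^sup>2 + e ^ 4)) +
       z * of_real (e * (d1 + 2 * d2 * y + d2 * e\<^sup>2 + d3 * (3 * y\<^sup>2 + 3 * y * e\<^sup>2 + e ^ 4))))
     - of_real (a + y)"

text \<open>At \<open>y = dev n k\<close>, \<open>e = 1 / sqrt n\<close> and \<open>x = k / n\<close>, \<open>drift y e z\<close> is \<open>(1 - x) * F - x\<close> with \<open>F\<close> the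
  ratio of the exponential factors of \<open>V n z (k + 1)\<close> and \<open>V n z k\<close>; the sum below vanishes after an index shift because
  \<open>(k + 1) * (n choose (k + 1)) = (n - k) * (n choose k)\<close>.\<close>

lemma stein_identity:
  assumes n: "n > 0"
  shows "(\<Sum>k\<le>n. V n z k * drift (dev n k) (1 / sqrt n) z) = 0"
proof -
  define F where "F k = exp (of_real (real n * (P (dev n (Suc k)) - P (dev n k)))
    + z * of_real (X n (Suc k) - X n k))" for k
  have step: "of_nat (Suc k) * V n z (Suc k) = of_nat (n - k) * V n z k * F k" if "k < n" for k
  proof -
    have "exp (of_real (real n * P (dev n (Suc k))) + z * of_real (X n (Suc k)))
      = exp (of_real (real n * P (dev n k)) + z * of_real (X n k)) * F k"
      unfolding F_def exp_add[symmetric] by (simp add: algebra_simps)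
    moreover have "(of_nat (Suc k) :: complex) * of_nat (n choose Suc k) = of_nat (n - k) * of_nat (n choose k)"
    proof -
      have "Suc k * (n choose Suc k) = (n - k) * (n choose k)"
        using that by (metis Suc_times_binomial_add add_diff_inverse_nat binomial_absorb_comp binomial_absorption mult.commute not_less_iff_gr_or_eq)
      then show ?thesis by (metis of_nat_mult)
    qed
    moreover have "p * (q * r) = p' * (q' * r') * s" if "r = r' * s" "p * q = p' * q'" for p q r p' q' r' s :: complex
      using that by (simp add: mult.assoc[symmetric])
    ultimately show ?thesis unfolding V_def by blast
  qed
  obtain m where m: "n = Suc m" using n by (metis gr0_implies_Suc)
  have "(\<Sum>k\<le>n. of_nat k * V n z k) = (\<Sum>k\<le>m. of_nat (Suc k) * V n z (Suc k))"
    unfolding m by (subst sum.atMost_Suc_shift) simp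
  also have "\<dots> = (\<Sum>k\<le>m. of_nat (n - k) * V n z k * F k)"
    by (intro sum.cong step) (auto simp: m)
  \<comment> \<open>The added term \<open>k = n\<close> carries the factor
    \<open>n - k = 0\<close>.\<close>
  also have "\<dots> = (\<Sum>k\<le>n. of_nat (n - k) * V n z k * F k)"
    unfolding m by simp
  finally have eq: "(\<Sum>k\<le>n. of_nat (n - k) * V n z k * F k) - (\<Sum>k\<le>n. of_nat k * V n z k) = 0" by simp
  have "of_nat (n - k) * V n z k * F k - of_nat k * V n z k =
     of_nat n * (V n z k * drift (dev n k) (1 / sqrt n) z)" if "k \<le> n" for k
  proof -
    define y where "y = dev n k"
    define e where "e = 1 / sqrt n"
    have e: "e\<^sup>2 = 1 / n" "n * e\<^sup>2 = 1" "sqrt n * e = 1" "n * e ^ 4 = e\<^sup>2"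
      using n by (auto simp: e_def power_divide field_simps power4_eq_xxxx power2_eq_square)
    \<comment> \<open>One more plus spin moves \<open>dev\<close> by
      \<open>1 / n = e\<^sup>2\<close>. Because \<open>n * e\<^sup>2 = 1\<close> and
      \<open>sqrt n * e = 1\<close>, the increments of \<open>n * P\<close> and of
      \<open>X n\<close> are exactly the polynomials in the exponent of
      \<open>drift\<close>.\<close>
    have y': "dev n (Suc k) = y + e\<^sup>2" unfolding e y_def using n by (simp add: dev_def field_simps)
    have "n * (P (y + e\<^sup>2) - P y) = (n * e\<^sup>2) * (c1 + 2 * c2 * y + c2 * e\<^sup>2 + c3 * (3 * y\<^sup>2 + 3 * y * e\<^sup>2 + e ^ 4))"
      by (simp add: P_def power2_eq_square power3_eq_cube power4_eq_xxxx algebra_simps)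
    then have "n * (P (y + e\<^sup>2) - P y) = c1 + 2 * c2 * y + c2 * e\<^sup>2 + c3 * (3 * y\<^sup>2 + 3 * y * e\<^sup>2 + e ^ 4)"
      unfolding e(2) by simp
    moreover
    have "sqrt n * Q (y + e\<^sup>2) - sqrt n * Q y = (sqrt n * e) * e * (d1 + 2 * d2 * y + d2 * e\<^sup>2 + d3 * (3 * y\<^sup>2 + 3 * y * e\<^sup>2 + e ^ 4))"
      by (simp add: Q_def power2_eq_square power3_eq_cube power4_eq_xxxx algebra_simps)
    then have "X n (Suc k) - X n k = e * (d1 + 2 * d2 * y + d2 * e\<^sup>2 + d3 * (3 * y\<^sup>2 + 3 * y * e\<^sup>2 + e ^ 4))"
      unfolding e(3) X_def y' y_def by simp
    ultimately have dr: "drift y e z = of_real (1 - a - y) * F k - of_real (a + y)"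
      by (simp only: drift_def F_def y' y_def[symmetric])
    have "real n * (1 - a - y) = real (n - k)" "real n * (a + y) = real k"
      using n that by (auto simp: y_def dev_def of_nat_diff field_simps)
    then have "of_nat n * complex_of_real (1 - a - y) = of_nat (n - k)" "of_nat n * complex_of_real (a + y) = of_nat k"
      by (metis of_real_mult of_real_of_nat_eq)+
    then have "of_nat n * drift y e z = of_nat (n - k) * F k - of_nat k"
      unfolding dr right_diff_distrib mult.assoc[symmetric] by simp
    then have "of_nat n * (V n z k * drift y e z) = V n z k * (of_nat (n - k) * F k - of_nat k)"
      by (simp add: mult.left_commute)
    then show ?thesis unfolding y_def e_def by (simp add: algebra_simps)
  qed
  then have "of_nat n * (\<Sum>k\<le>n. V n z k * drift (dev n k) (1 / sqrt n) z) = 0"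
    using eq unfolding sum_distrib_left sum_subtractf[symmetric] by simp
  then show ?thesis using n by simp
qed

text \<open>A Taylor expansion in \<open>y\<close> and \<open>e\<close>, uniform in the tilt. The
  constant term vanishes because \<open>(1 - a) * exp c1 = a\<close>, and the coefficient of
  \<open>y\<close> is \<open>2 * a * c2 - 1 - exp c1 = - a * kappa\<close>; what is left is
  quadratic.\<close>

lemma drift_expansion:
  assumes S: "S \<ge> 0"
  obtains C where "C \<ge> 0"
    "\<And>y e z. \<bar>y\<bar> \<le> 1 \<Longrightarrow> 0 \<le> e \<Longrightarrow> e \<le> 1 \<Longrightarrow> \<bar>1 - a - y\<bar> \<le> 1 \<Longrightarrow> norm z \<le> S \<Longrightarrow>
      norm (drift y e z - of_real a * (z * of_real (e * d1) - of_real (kappa * y))) \<le> C * (y\<^sup>2 + e\<^sup>2)"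
proof -
  \<comment> \<open>\<open>C1\<close> will bound the part of the exponent beyond first order
    relative to \<open>y\<^sup>2 + e\<^sup>2\<close>, and \<open>C2\<close> the whole exponent,
    apart from \<open>c1\<close>, relative to \<open>\<bar>y\<bar> + e\<close>. The summands of
    \<open>C\<close> belong to the three remainder terms, and \<open>q\<close> is
    \<open>exp c1\<close>.\<close>
  define C1 where "C1 = \<bar>c2\<bar> + 4 * \<bar>c3\<bar> + S * (2 * \<bar>d2\<bar> + 4 * \<bar>d3\<bar>)"
  define C2 where "C2 = 2 * \<bar>c2\<bar> + S * \<bar>d1\<bar> + C1"
  define q where "q = a / (1 - a)"
  define C where "C = a * C1 + q * (2 * C2) + q * (exp (2 * C2) * (2 * C2\<^sup>2))"
  have C1: "C1 \<ge> 0" and C2: "C2 \<ge> 0" using S by (auto simp: C1_def C2_def)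
  have q: "q > 0" using a by (simp add: q_def)
  have "C \<ge> 0" using C1 C2 q a by (simp add: C_def)
  moreover have "norm (drift y e z - of_real a * (z * of_real (e * d1) - of_real (kappa * y))) \<le> C * (y\<^sup>2 + e\<^sup>2)"
    if y: "\<bar>y\<bar> \<le> 1" and e: "0 \<le> e" "e \<le> 1" and ay: "\<bar>1 - a - y\<bar> \<le> 1" and z: "norm z \<le> S" for y e z
  proof -
    define N where "N = y\<^sup>2 + e\<^sup>2"
    define T where "T = 3 * y\<^sup>2 + 3 * y * e\<^sup>2 + e ^ 4"
    define r where "r = of_real (c2 * e\<^sup>2 + c3 * T) + z * of_real (e * (2 * d2 * y + d2 * e\<^sup>2 + d3 * T))"
    define w where "w = of_real (2 * c2 * y) + z * of_real (e * d1) + r"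
    define E where "E = exp w - 1 - w"
    have N0: "N \<ge> 0" by (simp add: N_def)
    have e2: "e\<^sup>2 \<le> e" "e\<^sup>2 \<le> 1" using e by (auto simp: power2_eq_square mult_le_one mult_left_le)
    have y2: "y\<^sup>2 \<le> \<bar>y\<bar>" using y mult_left_le[of "\<bar>y\<bar>" "\<bar>y\<bar>"] by (simp add: power2_eq_square)
    have "\<bar>y\<bar> * e\<^sup>2 \<le> 1 * e\<^sup>2" using y by (intro mult_right_mono) auto
    moreover have "e ^ 4 \<le> e\<^sup>2" using e by (intro power_decreasing) auto
    moreover have "\<bar>T\<bar> \<le> 3 * y\<^sup>2 + 3 * (\<bar>y\<bar> * e\<^sup>2) + e ^ 4"
      unfolding T_def using abs_triangle_ineq[of "3 * y\<^sup>2 + 3 * y * e\<^sup>2" "e ^ 4"]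
        abs_triangle_ineq[of "3 * y\<^sup>2" "3 * y * e\<^sup>2"] e by (simp add: abs_mult)
    ultimately have "\<bar>T\<bar> \<le> 3 * y\<^sup>2 + 4 * e\<^sup>2" by simp
    then have T: "\<bar>T\<bar> \<le> 4 * N" unfolding N_def distrib_left[of 4] using zero_le_power2[of y] by linarith
    have ey: "2 * (e * \<bar>y\<bar>) \<le> N" using sum_squares_bound[of e "\<bar>y\<bar>"] by (simp add: N_def)
    have r1: "\<bar>c2 * e\<^sup>2 + c3 * T\<bar> \<le> (\<bar>c2\<bar> + 4 * \<bar>c3\<bar>) * N"
    proof -
      have "\<bar>c2 * e\<^sup>2\<bar> \<le> \<bar>c2\<bar> * N" unfolding abs_mult by (intro mult_left_mono) (auto simp: N_def)
      moreover have "\<bar>c3 * T\<bar> \<le> \<bar>c3\<bar> * (4 * N)" unfolding abs_mult using T by (intro mult_left_mono) auto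
      ultimately show ?thesis using abs_triangle_ineq[of "c2 * e\<^sup>2" "c3 * T"] by (simp add: algebra_simps)
    qed
    have r2: "\<bar>e * (2 * d2 * y + d2 * e\<^sup>2 + d3 * T)\<bar> \<le> (2 * \<bar>d2\<bar> + 4 * \<bar>d3\<bar>) * N"
    proof -
      have "e * (2 * d2 * y + d2 * e\<^sup>2 + d3 * T) = d2 * (2 * (e * y)) + d2 * (e * e\<^sup>2) + d3 * (e * T)"
        by (simp add: algebra_simps)
      moreover have "\<bar>d2 * (2 * (e * y))\<bar> \<le> \<bar>d2\<bar> * N"
        unfolding abs_mult[of d2] using ey e by (intro mult_left_mono) (auto simp: abs_mult)
      moreover have "\<bar>d2 * (e * e\<^sup>2)\<bar> \<le> \<bar>d2\<bar> * N"
      proof -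
        have "e * e\<^sup>2 \<le> 1 * e\<^sup>2" using e by (intro mult_right_mono) auto
        then have "\<bar>e * e\<^sup>2\<bar> \<le> N" using e by (simp add: N_def abs_mult add_increasing)
        then show ?thesis unfolding abs_mult[of d2] by (intro mult_left_mono) auto
      qed
      moreover have "\<bar>d3 * (e * T)\<bar> \<le> \<bar>d3\<bar> * (4 * N)"
      proof -
        have "\<bar>e * T\<bar> \<le> 1 * \<bar>T\<bar>" unfolding abs_mult using e by (intro mult_right_mono) auto
        then show ?thesis unfolding abs_mult[of d3] using T by (intro mult_left_mono) auto
      qed
      ultimately have "\<bar>e * (2 * d2 * y + d2 * e\<^sup>2 + d3 * T)\<bar> \<le> \<bar>d2\<bar> * N + \<bar>d2\<bar> * N + \<bar>d3\<bar> * (4 * N)"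
        by linarith
      then show ?thesis by (simp add: algebra_simps)
    qed
    have r: "norm r \<le> C1 * N"
    proof -
      have "norm r \<le> \<bar>c2 * e\<^sup>2 + c3 * T\<bar> + norm z * \<bar>e * (2 * d2 * y + d2 * e\<^sup>2 + d3 * T)\<bar>"
        unfolding r_def norm_mult[symmetric] norm_of_real[symmetric, where 'a=complex] by (rule norm_triangle_ineq)
      also have "norm z * \<bar>e * (2 * d2 * y + d2 * e\<^sup>2 + d3 * T)\<bar> \<le> S * ((2 * \<bar>d2\<bar> + 4 * \<bar>d3\<bar>) * N)"
        using z r2 S by (intro mult_mono) auto
      finally show ?thesis using r1 by (simp add: C1_def algebra_simps)
    qed
    have w1: "norm w \<le> C2 * (\<bar>y\<bar> + e)"
    proof -
      have "norm w \<le> \<bar>2 * c2 * y\<bar> + norm z * \<bar>e * d1\<bar> + norm r"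
        unfolding w_def norm_mult[symmetric] norm_of_real[symmetric, where 'a=complex]
        by (meson add_right_mono norm_triangle_ineq order_trans)
      moreover have "norm z * \<bar>e * d1\<bar> \<le> S * (\<bar>d1\<bar> * (\<bar>y\<bar> + e))"
      proof (intro mult_mono z S)
        have "\<bar>e * d1\<bar> = \<bar>d1\<bar> * e" using e by (simp add: abs_mult)
        also have "\<dots> \<le> \<bar>d1\<bar> * (\<bar>y\<bar> + e)" by (intro mult_left_mono) auto
        finally show "\<bar>e * d1\<bar> \<le> \<bar>d1\<bar> * (\<bar>y\<bar> + e)" .
      qed auto
      moreover have "C1 * N \<le> C1 * (\<bar>y\<bar> + e)" using C1 y2 e2 by (intro mult_left_mono) (auto simp: N_def)
      moreover have "\<bar>2 * c2 * y\<bar> \<le> 2 * \<bar>c2\<bar> * (\<bar>y\<bar> + e)"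
        unfolding abs_mult using e by (intro mult_mono) auto
      ultimately show ?thesis using r by (simp add: C2_def algebra_simps)
    qed
    have ye: "(\<bar>y\<bar> + e)\<^sup>2 \<le> 2 * N" using ey by (simp add: N_def power2_sum algebra_simps)
    have w2: "(norm w)\<^sup>2 \<le> 2 * C2\<^sup>2 * N"
    proof -
      have "(norm w)\<^sup>2 \<le> (C2 * (\<bar>y\<bar> + e))\<^sup>2" using w1 by (intro power_mono) auto
      also have "\<dots> = C2\<^sup>2 * (\<bar>y\<bar> + e)\<^sup>2" by (simp add: power_mult_distrib)
      also have "\<dots> \<le> C2\<^sup>2 * (2 * N)" using ye by (intro mult_left_mono) auto
      finally show ?thesis by simp
    qed
    have w3: "norm w \<le> 2 * C2"
    proof -
      have "C2 * (\<bar>y\<bar> + e) \<le> C2 * 2" using y e C2 by (intro mult_left_mono) auto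
      with w1 show ?thesis by simp
    qed
    have E: "norm E \<le> exp (2 * C2) * (2 * C2\<^sup>2 * N)"
    proof -
      have "norm (exp w - (\<Sum>i\<le>1. w ^ i / fact i)) \<le> exp (norm w) * (norm w ^ Suc 1) / fact 1"
        by (rule Taylor_exp_field)
      then have "norm E \<le> exp (norm w) * (norm w)\<^sup>2" by (simp add: E_def power2_eq_square diff_diff_add)
      also have "\<dots> \<le> exp (2 * C2) * (2 * C2\<^sup>2 * N)" using w2 w3 by (intro mult_mono) auto
      finally show ?thesis .
    qed
    have yw: "\<bar>y\<bar> * norm w \<le> 2 * C2 * N"
    proof -
      have "\<bar>y\<bar> * norm w \<le> \<bar>y\<bar> * (C2 * (\<bar>y\<bar> + e))" using w1 by (intro mult_left_mono) auto
      also have "\<dots> = C2 * (y\<^sup>2 + e * \<bar>y\<bar>)" by (simp add: power2_eq_square algebra_simps)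
      also have "\<dots> \<le> C2 * (2 * N)" using ey C2 zero_le_power2[of e] zero_le_power2[of y] unfolding N_def distrib_left[of 2] by (intro mult_left_mono) linarith+
      finally show ?thesis by simp
    qed
    have expc1: "exp (complex_of_real c1) = of_real q"
      using a by (simp add: exp_of_real c1 q_def exp_diff)
    have "exp (of_real (c1 + 2 * c2 * y + c2 * e\<^sup>2 + c3 * T) + z * of_real (e * (d1 + 2 * d2 * y + d2 * e\<^sup>2 + d3 * T)))
      = exp (of_real c1 + w)" unfolding w_def r_def by (simp add: algebra_simps)
    also have "\<dots> = of_real q * (1 + w + E)" unfolding exp_add expc1 E_def by simp
    finally have dr: "drift y e z = of_real (1 - a - y) * (of_real q * (1 + w + E)) - of_real (a + y)"
      unfolding drift_def T_def[symmetric] by simp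
    have "1 / (1 - a) = 1 + q" using a by (simp add: q_def field_simps)
    moreover have "a * (u - 2 * c2) = a * u - 2 * a * c2" for u by (simp add: algebra_simps)
    then have "a * kappa = a * (1 / (a * (1 - a))) - 2 * a * c2" unfolding kappa_def .
    then have "a * kappa = 1 / (1 - a) - 2 * a * c2" using a by simp
    ultimately have qa: "(1 - a) * q = a" "a * kappa = 1 + q - 2 * a * c2" using a by (simp_all add: q_def)
    have qa': "(1 - complex_of_real a) * of_real q = of_real a"
      "complex_of_real a * of_real kappa = 1 + of_real q - 2 * of_real a * of_real c2"
      using arg_cong[OF qa(1), of complex_of_real] arg_cong[OF qa(2), of complex_of_real] by simp_all
    \<comment> \<open>The products \<open>(1 - a) * q\<close> and \<open>a * kappa\<close> are
      isolated so that \<open>qa'\<close> can replace them; all terms of order at most one then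
      cancel.\<close>
    have "drift y e z - of_real a * (z * of_real (e * d1) - of_real (kappa * y))
      = ((1 - of_real a) * of_real q) * (1 + w + E) - of_real y * of_real q * (1 + w + E) - of_real a - of_real y
        - of_real a * z * of_real (e * d1) + (of_real a * of_real kappa) * of_real y"
      unfolding dr by (simp add: algebra_simps)
    also have "\<dots> = of_real a * r - of_real q * (of_real y * w) + of_real (1 - a - y) * (of_real q * E)"
    proof -
      have E': "of_real (1 - a - y) * (of_real q * E) = ((1 - of_real a) * of_real q) * E - of_real y * of_real q * E"
        by (simp add: algebra_simps)
      have r': "r = w - of_real (2 * c2 * y) - z * of_real (e * d1)" by (simp add: w_def)
      show ?thesis unfolding E' qa' r' by (simp add: algebra_simps)
    qed
    finally have eq: "drift y e z - of_real a * (z * of_real (e * d1) - of_real (kappa * y))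
      = of_real a * r - of_real q * (of_real y * w) + of_real (1 - a - y) * (of_real q * E)" .
    have n1: "norm (of_real a * r) \<le> a * (C1 * N)" using r a by (simp add: norm_mult)
    have n2: "norm (of_real q * (of_real y * w)) \<le> q * (2 * C2 * N)" using yw q by (simp add: norm_mult)
    have n3: "norm (of_real (1 - a - y) * (of_real q * E)) \<le> 1 * (q * (exp (2 * C2) * (2 * C2\<^sup>2 * N)))"
      unfolding norm_mult norm_of_real using ay q E by (intro mult_mono) auto
    have "norm (of_real a * r - of_real q * (of_real y * w) + of_real (1 - a - y) * (of_real q * E))
      \<le> norm (of_real a * r) + norm (of_real q * (of_real y * w)) + norm (of_real (1 - a - y) * (of_real q * E))"
      by (meson add_right_mono norm_triangle_ineq norm_triangle_ineq4 order_trans)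
    also have "\<dots> \<le> a * (C1 * N) + q * (2 * C2 * N) + 1 * (q * (exp (2 * C2) * (2 * C2\<^sup>2 * N)))"
      by (intro add_mono n1 n2 n3)
    also have "\<dots> = C * N" by (simp add: C_def algebra_simps)
    finally show ?thesis unfolding eq N_def .
  qed
  ultimately show ?thesis by (rule that)
qed

text \<open>This is \<open>sqrt n\<close> times the tilted mean of
  \<open>(dev n k)\<^sup>2 + 1 / n\<close>, the remainder of \<open>drift_expansion\<close> at
  \<open>e = 1 / sqrt n\<close>.\<close>

definition err :: "nat \<Rightarrow> real \<Rightarrow> real" where
  "err n t = sqrt n * spread n t / Z n t + 1 / sqrt n"

lemma err_tendsto: "(\<lambda>n. err n t) \<longlonglongrightarrow> 0"
proof -
  have "(\<lambda>n. 1 / sqrt (real n)) \<longlonglongrightarrow> 0" by real_asymp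
  then show ?thesis using tendsto_add[OF spread_tendsto, of "\<lambda>n. 1 / sqrt (real n)" 0 t] by (simp add: err_def)
qed

text \<open>The linear part of \<open>drift\<close> is proportional to
  \<open>v * z - sqrt n * d1 * dev n k\<close>, and \<open>drift\<close> itself sums to zero against
  \<open>V\<close>. So \<open>X n k - v * z\<close> averages to the expansion error plus the
  nonlinear part \<open>G\<close> of the statistic, both controlled by \<open>err\<close>.\<close>

lemma stein_bound:
  assumes S: "S \<ge> 0"
  obtains C where "C \<ge> 0"
    "\<And>n z. n > 0 \<Longrightarrow> norm z \<le> S \<Longrightarrow>
      norm (\<Sum>k\<le>n. V n z k * (of_real (X n k) - of_real v * z)) \<le> C * err n (Re z) * Z n (Re z)"
proof -
  from drift_expansion[OF S] obtain C where C: "C \<ge> 0"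
    "\<And>y e z. \<bar>y\<bar> \<le> 1 \<Longrightarrow> 0 \<le> e \<Longrightarrow> e \<le> 1 \<Longrightarrow> \<bar>1 - a - y\<bar> \<le> 1 \<Longrightarrow> norm z \<le> S \<Longrightarrow>
      norm (drift y e z - of_real a * (z * of_real (e * d1) - of_real (kappa * y))) \<le> C * (y\<^sup>2 + e\<^sup>2)"
    by blast
  define B where "B = \<bar>d1\<bar> / (a * kappa)"
  define L where "L = \<bar>d2\<bar> + \<bar>d3\<bar>"
  have B: "B \<ge> 0" and L: "L \<ge> 0" using a kappa_pos by (auto simp: B_def L_def)
  have "B * C + L \<ge> 0" using B C(1) L by simp
  moreover have "norm (\<Sum>k\<le>n. V n z k * (of_real (X n k) - of_real v * z)) \<le> (B * C + L) * err n (Re z) * Z n (Re z)"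
    if n: "n > 0" and z: "norm z \<le> S" for n z
  proof -
    define e where "e = 1 / sqrt n"
    define t where "t = Re z"
    have e: "0 \<le> e" "e \<le> 1" "e * sqrt n = 1"
      using n by (auto simp: e_def)
    then have e4: "sqrt n * e\<^sup>2 = e" by (metis mult.assoc mult.commute mult_1 power2_eq_square)
    define R where "R k = drift (dev n k) e z - of_real a * (z * of_real (e * d1) - of_real (kappa * dev n k))" for k
    have R: "norm (R k) \<le> C * ((dev n k)\<^sup>2 + e\<^sup>2)" if k: "k \<le> n" for k
    proof -
      have "1 - a - dev n k = 1 - real k / real n" by (simp add: dev_def)
      moreover have "0 \<le> real k / real n" "real k / real n \<le> 1" using k n by auto
      ultimately have "\<bar>1 - a - dev n k\<bar> \<le> 1" by linarith
      then show ?thesis unfolding R_def using e z k n by (intro C(2) abs_dev_le) auto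
    qed
    define G where "G k = sqrt n * (d2 * (dev n k)\<^sup>2 + d3 * (dev n k) ^ 3)" for k
    have G: "\<bar>G k\<bar> \<le> sqrt n * (L * (dev n k)\<^sup>2)" if k: "k \<le> n" for k
      unfolding G_def abs_mult[of "sqrt n"] L_def using cubic_remainder_le[OF abs_dev_le[OF k n]]
      by (intro mult_mono) auto
    \<comment> \<open>The factor is chosen so that \<open>b * a * kappa = sqrt n * d1\<close> and
      \<open>b * a * (e * d1) = v\<close>.\<close>
    define b where "b = d1 * sqrt n / (a * kappa)"
    have b: "\<bar>b\<bar> = B * sqrt n" using a kappa_pos by (simp add: b_def B_def abs_mult)
    have eq: "of_real (X n k) - of_real v * z = of_real b * R k - of_real b * drift (dev n k) e z + of_real (G k)" for k
    proof -
      have x: "X n k = sqrt n * d1 * dev n k + G k" by (simp add: X_def Q_def G_def algebra_simps)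
      have "b * a * (e * d1) = (e * sqrt n) * (d1\<^sup>2 / kappa)" using a kappa_pos by (simp add: b_def power2_eq_square field_simps)
      then have v: "v = b * a * (e * d1)" unfolding e(3) v_def by simp
      have b2: "b * a * kappa = sqrt n * d1" using a kappa_pos by (simp add: b_def)
      have x': "complex_of_real (X n k) = of_real b * of_real a * of_real kappa * of_real (dev n k) + of_real (G k)"
        unfolding x b2[symmetric] by simp
      show ?thesis unfolding x' v R_def by (simp add: algebra_simps)
    qed
    have "(\<Sum>k\<le>n. V n z k * (of_real (X n k) - of_real v * z)) =
      of_real b * (\<Sum>k\<le>n. V n z k * R k) - of_real b * (\<Sum>k\<le>n. V n z k * drift (dev n k) e z)
       + (\<Sum>k\<le>n. V n z k * of_real (G k))"
      unfolding eq sum_distrib_left sum.distrib[symmetric] sum_subtractf[symmetric]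
      by (intro sum.cong) (auto simp: algebra_simps)
    also have "(\<Sum>k\<le>n. V n z k * drift (dev n k) e z) = 0" unfolding e_def by (rule stein_identity[OF n])
    finally have "norm (\<Sum>k\<le>n. V n z k * (of_real (X n k) - of_real v * z)) \<le>
      norm (of_real b * (\<Sum>k\<le>n. V n z k * R k)) + norm (\<Sum>k\<le>n. V n z k * of_real (G k))"
      by (simp add: norm_triangle_ineq)
    also have "norm (of_real b * (\<Sum>k\<le>n. V n z k * R k)) = B * sqrt n * norm (\<Sum>k\<le>n. V n z k * R k)"
      by (simp add: norm_mult b)
    also have "norm (\<Sum>k\<le>n. V n z k * R k) \<le> (\<Sum>k\<le>n. W n t k * (C * ((dev n k)\<^sup>2 + e\<^sup>2)))"
      using R by (intro sum_norm_le) (auto simp: norm_mult norm_V t_def intro!: mult_left_mono W_nonneg)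
    also have "\<dots> = C * (spread n t + Z n t * e\<^sup>2)"
      by (simp add: spread_def Z_def sum_distrib_left sum_distrib_right sum.distrib algebra_simps)
    also have "norm (\<Sum>k\<le>n. V n z k * of_real (G k)) \<le> (\<Sum>k\<le>n. W n t k * (sqrt n * (L * (dev n k)\<^sup>2)))"
      using G by (intro sum_norm_le) (auto simp: norm_mult norm_V t_def intro!: mult_left_mono W_nonneg)
    also have "\<dots> = L * (sqrt n * spread n t)"
      by (simp add: spread_def sum_distrib_left algebra_simps)
    finally have "norm (\<Sum>k\<le>n. V n z k * (of_real (X n k) - of_real v * z)) \<le>
      B * sqrt n * (C * (spread n t + Z n t * e\<^sup>2)) + L * (sqrt n * spread n t)"
      using B by (simp add: mult_left_mono)
    also have "\<dots> = (B * C + L) * (sqrt n * spread n t) + B * C * Z n t * (sqrt n * e\<^sup>2)" by (simp add: algebra_simps)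
    also have "\<dots> \<le> (B * C + L) * (sqrt n * spread n t) + (B * C + L) * Z n t * (sqrt n * e\<^sup>2)"
      using L Z_pos[of n t] e unfolding e4 by (intro add_mono mult_right_mono order_refl) auto
    also have "\<dots> = (B * C + L) * err n t * Z n t"
      unfolding e4 err_def e_def[symmetric] using Z_pos[of n t] by (simp add: field_simps)
    finally show ?thesis unfolding t_def .
  qed
  ultimately show ?thesis by (rule that)
qed

section \<open>Limits of the tilted mean and of the characteristic function\<close>

definition mean :: "nat \<Rightarrow> real \<Rightarrow> real" where
  "mean n t = (\<Sum>k\<le>n. W n t k * X n k) / Z n t"

text \<open>This is \<open>stein_bound\<close> at the real point \<open>z = t\<close>, divided by
  \<open>Z n t\<close>.\<close>

lemma mean_tendsto: "(\<lambda>n. mean n t) \<longlonglongrightarrow> v * t"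
proof -
  from stein_bound[of "\<bar>t\<bar>"] obtain C where C: "C \<ge> 0"
    "\<And>n z. n > 0 \<Longrightarrow> norm z \<le> \<bar>t\<bar> \<Longrightarrow>
      norm (\<Sum>k\<le>n. V n z k * (of_real (X n k) - of_real v * z)) \<le> C * err n (Re z) * Z n (Re z)"
    by auto
  have "norm (mean n t - v * t) \<le> C * err n t" if n: "n > 0" for n
  proof -
    have "(\<Sum>k\<le>n. V n (of_real t) k * (of_real (X n k) - of_real v * of_real t)) =
      complex_of_real (\<Sum>k\<le>n. W n t k * (X n k - v * t))"
      unfolding V_of_real by simp
    also have "(\<Sum>k\<le>n. W n t k * (X n k - v * t)) = Z n t * (mean n t - v * t)"
    proof -
      have "(\<Sum>k\<le>n. W n t k * (X n k - v * t)) = (\<Sum>k\<le>n. W n t k * X n k) - Z n t * (v * t)"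
        by (simp add: right_diff_distrib sum_subtractf Z_def sum_distrib_right)
      then show ?thesis using Z_pos[of n t] by (simp add: mean_def right_diff_distrib)
    qed
    finally have "Z n t * \<bar>mean n t - v * t\<bar> \<le> C * err n t * Z n t"
      using C(2)[OF n, of "of_real t"] Z_pos[of n t] by (simp add: abs_mult norm_mult flip: of_real_diff of_real_mult)
    then show ?thesis using Z_pos[of n t] by (simp add: mult.commute)
  qed
  then have "eventually (\<lambda>n. norm (mean n t - v * t) \<le> C * err n t) sequentially"
    by (intro eventually_mono[OF eventually_gt_at_top[of 0]])
  moreover have "(\<lambda>n. C * err n t) \<longlonglongrightarrow> 0" using tendsto_mult_right_zero[OF err_tendsto] .
  ultimately have "(\<lambda>n. mean n t - v * t) \<longlonglongrightarrow> 0" by (rule Lim_null_comparison)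
  then show ?thesis by (simp add: LIM_zero_iff)
qed

text \<open>The Stein sum is the defect in the differential equation \<open>F' = v * z * F\<close>
  for \<open>F z = (\<Sum>k\<le>n. V n z k)\<close>. Multiplying by the integrating factor
  \<open>exp (- v * z\<^sup>2 / 2)\<close> gives an almost constant function
  \<open>g\<close>.\<close>

lemma charfun_tendsto: "(\<lambda>n. (\<Sum>k\<le>n. V n (\<i> * of_real s) k) / of_real (Z n 0)) \<longlonglongrightarrow> of_real (exp (- (v * s\<^sup>2 / 2)))"
proof -
  from stein_bound[of "\<bar>s\<bar>"] obtain C where C: "C \<ge> 0"
    "\<And>n z. n > 0 \<Longrightarrow> norm z \<le> \<bar>s\<bar> \<Longrightarrow>
      norm (\<Sum>k\<le>n. V n z k * (of_real (X n k) - of_real v * z)) \<le> C * err n (Re z) * Z n (Re z)"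
    by auto
  have v: "v \<ge> 0" using kappa_pos by (simp add: v_def)
  have bound: "norm ((\<Sum>k\<le>n. V n (\<i> * of_real s) k) / of_real (Z n 0) - of_real (exp (- (v * s\<^sup>2 / 2)))) \<le> C * err n 0 * \<bar>s\<bar>"
    if n: "n > 0" for n
  proof -
    define g where "g z = (\<Sum>k\<le>n. V n z k) * exp (- (of_real v * z\<^sup>2 / 2))" for z
    define g' where "g' z = (\<Sum>k\<le>n. V n z k * (of_real (X n k) - of_real v * z)) * exp (- (of_real v * z\<^sup>2 / 2))" for z
    define B where "B = C * err n 0 * Z n 0 * exp (v * s\<^sup>2 / 2)"
    \<comment> \<open>On this imaginary segment the real part of \<open>z\<close> is 0, so the error
      and the normalization are always those of tilt 0.\<close>
    define S where "S = closed_segment 0 (\<i> * complex_of_real s)"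
    have S: "Re z = 0 \<and> \<bar>Im z\<bar> \<le> \<bar>s\<bar>" if "z \<in> S" for z
      using that by (auto simp: S_def closed_segment_def abs_mult intro!: mult_left_le_one_le)
    have "norm (g (\<i> * of_real s) - g 0) \<le> B * norm (\<i> * of_real s - 0)"
    proof (rule field_differentiable_bound[where f' = g' and S = S])
      fix z assume "z \<in> S"
      have dV: "((\<lambda>z. V n z k) has_field_derivative V n z k * of_real (X n k)) (at z within S)" for k
        unfolding V_def by (auto intro!: derivative_eq_intros)
      have dS: "((\<lambda>z. \<Sum>k\<le>n. V n z k) has_field_derivative (\<Sum>k\<le>n. V n z k * of_real (X n k))) (at z within S)"
        by (intro DERIV_sum dV)
      have dE: "((\<lambda>z. exp (- (of_real v * z\<^sup>2 / 2))) has_field_derivative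
          exp (- (of_real v * z\<^sup>2 / 2)) * (- (of_real v * z))) (at z within S)"
        by (auto intro!: derivative_eq_intros)
      have "(g has_field_derivative (\<Sum>k\<le>n. V n z k * of_real (X n k)) * exp (- (of_real v * z\<^sup>2 / 2))
         + exp (- (of_real v * z\<^sup>2 / 2)) * (- (of_real v * z)) * (\<Sum>k\<le>n. V n z k)) (at z within S)"
        unfolding g_def by (rule DERIV_mult[OF dS dE])
      also have "(\<Sum>k\<le>n. V n z k * of_real (X n k)) * exp (- (of_real v * z\<^sup>2 / 2))
         + exp (- (of_real v * z\<^sup>2 / 2)) * (- (of_real v * z)) * (\<Sum>k\<le>n. V n z k) = g' z"
        by (simp add: g'_def sum_subtractf right_diff_distrib sum_distrib_left sum_distrib_right algebra_simps)
      finally show "(g has_field_derivative g' z) (at z within S)" .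
      have z: "Re z = 0" "\<bar>Im z\<bar> \<le> \<bar>s\<bar>" using S[OF \<open>z \<in> S\<close>] by auto
      have nz: "norm z = \<bar>Im z\<bar>" using z(1) by (simp add: norm_complex_def)
      have "Re (z\<^sup>2) = - (Im z)\<^sup>2" using z(1) by (simp add: power2_eq_square)
      then have "norm (exp (- (of_real v * z\<^sup>2 / 2))) = exp (v * (Im z)\<^sup>2 / 2)" by simp
      also have "\<dots> \<le> exp (v * s\<^sup>2 / 2)" using v z(2) by (simp add: mult_left_mono abs_le_square_iff)
      finally have ex: "norm (exp (- (of_real v * z\<^sup>2 / 2))) \<le> exp (v * s\<^sup>2 / 2)" .
      have st: "norm (\<Sum>k\<le>n. V n z k * (of_real (X n k) - of_real v * z)) \<le> C * err n 0 * Z n 0"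
        using C(2)[OF n, of z] z nz by simp
      show "norm (g' z) \<le> B"
        unfolding g'_def B_def norm_mult using st ex order_trans[OF norm_ge_zero st]
        by (intro mult_mono) auto
    qed (auto simp: S_def)
    moreover have "g 0 = of_real (Z n 0)" using V_of_real[of n 0] by (simp add: g_def Z_def)
    moreover have "exp (- (of_real v * (\<i> * complex_of_real s)\<^sup>2 / 2)) = of_real (exp (v * s\<^sup>2 / 2))"
      by (simp add: power_mult_distrib exp_of_real[symmetric])
    ultimately have *: "norm ((\<Sum>k\<le>n. V n (\<i> * of_real s) k) * of_real (exp (v * s\<^sup>2 / 2)) - of_real (Z n 0)) \<le> B * \<bar>s\<bar>"
      by (simp add: g_def norm_mult)
    define N where "N = (\<Sum>k\<le>n. V n (\<i> * of_real s) k)"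
    let ?E = "exp (v * s\<^sup>2 / 2)"
    have E: "complex_of_real (exp (- (v * s\<^sup>2 / 2))) = 1 / of_real ?E"
      unfolding exp_minus of_real_inverse by (rule inverse_eq_divide)
    have quot: "norm (N / of_real p - 1 / of_real q) = norm (N * of_real q - of_real p) / (p * q)"
      if "p > 0" "q > 0" for p q
    proof -
      have "N / of_real p - 1 / of_real q = (N * of_real q - of_real p) / of_real (p * q)"
        using that by (simp add: field_simps)
      then show ?thesis using that by (simp add: norm_divide norm_mult)
    qed
    have "norm (N / of_real (Z n 0) - 1 / of_real ?E) = norm (N * of_real ?E - of_real (Z n 0)) / (Z n 0 * ?E)"
      by (intro quot Z_pos exp_gt_zero)
    also have "\<dots> \<le> B * \<bar>s\<bar> / (Z n 0 * ?E)"
      using * Z_pos[of n 0] unfolding N_def by (intro divide_right_mono) auto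
    also have "\<dots> = C * err n 0 * \<bar>s\<bar>" using Z_pos[of n 0] by (simp add: B_def)
    finally show ?thesis unfolding N_def E .
  qed
  then have "eventually (\<lambda>n. norm ((\<Sum>k\<le>n. V n (\<i> * of_real s) k) / of_real (Z n 0) - of_real (exp (- (v * s\<^sup>2 / 2))))
     \<le> C * err n 0 * \<bar>s\<bar>) sequentially"
    by (intro eventually_mono[OF eventually_gt_at_top[of 0]])
  moreover have "(\<lambda>n. C * err n 0 * \<bar>s\<bar>) \<longlonglongrightarrow> 0"
    by (intro tendsto_mult_left_zero tendsto_mult_right_zero err_tendsto)
  ultimately have "(\<lambda>n. (\<Sum>k\<le>n. V n (\<i> * of_real s) k) / of_real (Z n 0) - of_real (exp (- (v * s\<^sup>2 / 2)))) \<longlonglongrightarrow> 0"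
    by (rule Lim_null_comparison)
  then show ?thesis by (simp add: LIM_zero_iff)
qed

end

section \<open>Gibbs measures on spin configurations\<close>

lemma finite_configs: "finite (configs n)"
  by (auto simp: configs_def intro!: finite_PiE)

text \<open>Configurations are grouped by their set of plus spins, and \<open>n choose k\<close> of
  these sets have \<open>k\<close> elements. Vector values are allowed because the characteristic
  function needs complex ones.\<close>

lemma sum_configs:
  fixes F :: "real \<Rightarrow> 'a :: real_vector"
  shows "(\<Sum>\<omega>\<in>configs n. F (plus_fraction n \<omega>)) = (\<Sum>k\<le>n. real (n choose k) *\<^sub>R F (real k / real n))"
proof -
  let ?g = "\<lambda>\<omega>::nat \<Rightarrow> real. card {i. i < n \<and> \<omega> i = 1}"
  have gn: "?g \<omega> \<le> n" for \<omega> using card_mono[of "{..<n}" "{i. i < n \<and> \<omega> i = 1}"] by auto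
  have card: "card {\<omega>\<in>configs n. ?g \<omega> = k} = n choose k" for k
  proof -
    have "bij_betw (\<lambda>\<omega>. {i. i < n \<and> \<omega> i = 1}) {\<omega>\<in>configs n. ?g \<omega> = k} {B. B \<subseteq> {..<n} \<and> card B = k}"
    proof (rule bij_betw_byWitness[where f' = "\<lambda>B. \<lambda>i\<in>{..<n}. if i \<in> B then 1 else - 1"])
      show "\<forall>\<omega>\<in>{\<omega>\<in>configs n. ?g \<omega> = k}. (\<lambda>i\<in>{..<n}. if i \<in> {i. i < n \<and> \<omega> i = 1} then 1 else - 1) = \<omega>"
        by (auto simp: configs_def fun_eq_iff restrict_def PiE_iff extensional_def)
      show "(\<lambda>B. \<lambda>i\<in>{..<n}. if i \<in> B then 1 else - 1) ` {B. B \<subseteq> {..<n} \<and> card B = k} \<subseteq> {\<omega>\<in>configs n. ?g \<omega> = k}"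
      proof clarify
        fix B assume B: "B \<subseteq> {..<n}"
        then have "{i. i < n \<and> (\<lambda>i\<in>{..<n}. if i \<in> B then 1 else - 1 :: real) i = 1} = B" by auto
        then show "(\<lambda>i\<in>{..<n}. if i \<in> B then 1 else - 1) \<in> configs n \<and>
          ?g (\<lambda>i\<in>{..<n}. if i \<in> B then 1 else - 1) = card B" by (auto simp: configs_def)
      qed
    qed auto
    then show ?thesis by (simp add: bij_betw_same_card n_subsets)
  qed
  have "(\<Sum>\<omega>\<in>configs n. F (plus_fraction n \<omega>)) = (\<Sum>k\<le>n. \<Sum>\<omega>\<in>{\<omega>\<in>configs n. ?g \<omega> = k}. F (plus_fraction n \<omega>))"
    using finite_configs gn by (intro sum.group[symmetric]) auto
  also have "\<dots> = (\<Sum>k\<le>n. \<Sum>\<omega>\<in>{\<omega>\<in>configs n. ?g \<omega> = k}. F (real k / real n))"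
    by (intro sum.cong) (auto simp: plus_fraction_def)
  also have "\<dots> = (\<Sum>k\<le>n. real (n choose k) *\<^sub>R F (real k / real n))"
    unfolding sum_constant_scaleR card ..
  finally show ?thesis .
qed

definition gibbs_sum :: "nat \<Rightarrow> (real \<Rightarrow> real) \<Rightarrow> real" where
  "gibbs_sum n f = (\<Sum>\<omega>\<in>configs n. exp (real n * f (plus_fraction n \<omega>)))"

text \<open>With an arbitrary potential, a change of \<open>\<beta>\<close> or of \<open>h\<close>
  becomes one operation, namely adding a multiple of the statistic to \<open>f\<close>.\<close>

definition gibbs :: "nat \<Rightarrow> (real \<Rightarrow> real) \<Rightarrow> (nat \<Rightarrow> real) measure" where
  "gibbs n f = point_measure (configs n) (\<lambda>\<omega>. ennreal (exp (real n * f (plus_fraction n \<omega>)) / gibbs_sum n f))"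

lemma cubic_measure_gibbs: "cubic_measure n \<beta> h = gibbs n (cubic_f \<beta> h)"
  by (simp add: cubic_measure_def gibbs_def partition_fn_def gibbs_sum_def)

lemma gibbs_sum_pos: "gibbs_sum n f > 0"
  unfolding gibbs_sum_def
  by (intro sum_pos finite_configs) (auto simp: configs_def PiE_eq_empty_iff)

lemma space_gibbs: "space (gibbs n f) = configs n"
  by (simp add: gibbs_def space_point_measure)

lemma measurable_gibbs: "F \<in> borel_measurable (gibbs n f)"
  by (simp add: gibbs_def)

lemma prob_space_gibbs: "prob_space (gibbs n f)"
  unfolding gibbs_def
proof (rule prob_space_point_measure[OF finite_configs])
  have "(\<Sum>\<omega>\<in>configs n. ennreal (exp (real n * f (plus_fraction n \<omega>)) / gibbs_sum n f)) =
    ennreal (\<Sum>\<omega>\<in>configs n. exp (real n * f (plus_fraction n \<omega>)) / gibbs_sum n f)"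
    using gibbs_sum_pos[of n f] by (intro sum_ennreal) auto
  also have "(\<Sum>\<omega>\<in>configs n. exp (real n * f (plus_fraction n \<omega>)) / gibbs_sum n f) = 1"
    using gibbs_sum_pos[of n f] by (simp add: sum_divide_distrib[symmetric] gibbs_sum_def)
  finally show "(\<Sum>\<omega>\<in>configs n. ennreal (exp (real n * f (plus_fraction n \<omega>)) / gibbs_sum n f)) = 1" by simp
qed auto

lemma integral_gibbs:
  fixes F :: "real \<Rightarrow> 'a :: {banach, second_countable_topology}"
  shows "(LINT \<eta>|gibbs n f. F (plus_fraction n \<eta>)) =
    (1 / (\<Sum>k\<le>n. real (n choose k) * exp (real n * f (real k / real n)))) *\<^sub>R
      (\<Sum>k\<le>n. (real (n choose k) * exp (real n * f (real k / real n))) *\<^sub>R F (real k / real n))"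
proof -
  have Z: "gibbs_sum n f = (\<Sum>k\<le>n. real (n choose k) * exp (real n * f (real k / real n)))"
    unfolding gibbs_sum_def using sum_configs[of "\<lambda>x. exp (real n * f x)" n] by simp
  have "(LINT \<eta>|gibbs n f. F (plus_fraction n \<eta>)) =
    (\<Sum>\<omega>\<in>configs n. (exp (real n * f (plus_fraction n \<omega>)) / gibbs_sum n f) *\<^sub>R F (plus_fraction n \<omega>))"
    unfolding gibbs_def using gibbs_sum_pos[of n f]
    by (intro lebesgue_integral_point_measure_finite finite_configs) auto
  also have "\<dots> = (\<Sum>k\<le>n. real (n choose k) *\<^sub>R ((exp (real n * f (real k / real n)) / gibbs_sum n f) *\<^sub>R F (real k / real n)))"
    by (rule sum_configs)
  also have "\<dots> = (1 / gibbs_sum n f) *\<^sub>R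
      (\<Sum>k\<le>n. (real (n choose k) * exp (real n * f (real k / real n))) *\<^sub>R F (real k / real n))"
    by (simp add: scaleR_sum_right)
  finally show ?thesis unfolding Z .
qed

section \<open>Tilted Gibbs measures and the limit law of an estimator\<close>

context cubic_laplace
begin

lemma continuous_mean: "continuous_on UNIV (mean n)"
proof -
  have "continuous_on UNIV (\<lambda>t. (\<Sum>k\<le>n. W n t k * X n k) / Z n t)"
    using Z_pos[of n] unfolding Z_def W_def by (intro continuous_intros) (auto simp: less_le)
  then show ?thesis by (simp add: mean_def[abs_def])
qed

text \<open>Chebyshev's association argument: in a symmetrized double sum \<open>X\<close> and
  \<open>exp (\<delta> * X)\<close> are similarly ordered, so every term is nonnegative, and the
  pair \<open>i\<close>, \<open>j\<close> makes the sum strictly positive.\<close>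

lemma strict_mono_mean:
  assumes ij: "i \<le> n" "j \<le> n" "X n i \<noteq> X n j"
  shows "strict_mono (mean n)"
proof (rule strict_monoI)
  fix s t :: real assume st: "s < t"
  define \<delta> where "\<delta> = t - s"
  have \<delta>: "\<delta> > 0" using st by (simp add: \<delta>_def)
  define E where "E k = exp (\<delta> * X n k)" for k
  have W: "W n t k = W n s k * E k" for k
    by (simp add: W_def E_def \<delta>_def exp_add[symmetric] algebra_simps)
  have Wpos: "k \<le> n \<Longrightarrow> W n s k > 0" for k by (simp add: W_def)
  define T where "T k l = W n s k * W n s l * ((X n k - X n l) * (E k - E l))" for k l
  have mono: "(x - y) * (exp (\<delta> * x) - exp (\<delta> * y)) > 0" if "x \<noteq> y" for x y
    using that \<delta> by (cases "x < y") (auto simp: zero_less_mult_iff)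
  have T0: "T k l \<ge> 0" for k l
    unfolding T_def E_def using mono[of "X n k" "X n l"] W_nonneg
    by (cases "X n k = X n l") (auto intro!: mult_nonneg_nonneg)
  have Tij: "T i j > 0" unfolding T_def E_def using mono[OF ij(3)] Wpos ij by simp
  have Ti: "0 < (\<Sum>l\<le>n. T i l)" by (rule sum_pos2[of _ j]) (use Tij T0 ij in auto)
  have "0 < (\<Sum>k\<le>n. \<Sum>l\<le>n. T k l)"
    by (rule sum_pos2[of _ i]) (use Ti T0 ij in \<open>auto intro!: sum_nonneg\<close>)
  \<comment> \<open>Exchanging the two indices shows that both halves coincide; each is the
    difference of the two means after clearing denominators.\<close>
  also have "(\<Sum>k\<le>n. \<Sum>l\<le>n. T k l) =
     (\<Sum>k\<le>n. \<Sum>l\<le>n. W n s k * W n s l * ((X n k - X n l) * E k))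
     + (\<Sum>k\<le>n. \<Sum>l\<le>n. W n s k * W n s l * ((X n l - X n k) * E l))"
    unfolding sum.distrib[symmetric] T_def by (intro sum.cong refl) (simp add: algebra_simps)
  also have "(\<Sum>k\<le>n. \<Sum>l\<le>n. W n s k * W n s l * ((X n l - X n k) * E l)) =
    (\<Sum>k\<le>n. \<Sum>l\<le>n. W n s k * W n s l * ((X n k - X n l) * E k))"
    by (subst sum.swap) (intro sum.cong refl, simp add: mult_ac)
  also have "(\<Sum>k\<le>n. \<Sum>l\<le>n. W n s k * W n s l * ((X n k - X n l) * E k)) =
     (\<Sum>k\<le>n. W n t k * X n k) * Z n s - (\<Sum>l\<le>n. W n s l * X n l) * Z n t"
  proof -
    have "(\<Sum>k\<le>n. W n t k * X n k) * Z n s = (\<Sum>k\<le>n. \<Sum>l\<le>n. W n t k * X n k * W n s l)"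
      unfolding Z_def by (rule sum_product)
    moreover have "(\<Sum>l\<le>n. W n s l * X n l) * Z n t = (\<Sum>k\<le>n. \<Sum>l\<le>n. W n s l * X n l * W n t k)"
      unfolding Z_def sum_product by (rule sum.swap)
    ultimately show ?thesis
      unfolding sum_subtractf[symmetric] W by (simp add: sum_subtractf[symmetric] algebra_simps)
  qed
  finally have less: "(\<Sum>l\<le>n. W n s l * X n l) * Z n t < (\<Sum>k\<le>n. W n t k * X n k) * Z n s" by linarith
  have cross: "x / p < y / q" if "x * q < y * p" "p > 0" "q > 0" for x y p q :: real
    using that by (simp add: field_simps)
  show "mean n s < mean n t" unfolding mean_def by (rule cross[OF less Z_pos Z_pos])
qed

text \<open>Adding \<open>s * \<phi>\<close> to the potential changes the exponent by
  \<open>s * sqrt n * X n k\<close> up to a constant, so a parameter shift \<open>s\<close> is the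
  tilt \<open>s * sqrt n\<close>.\<close>

lemma integral_tilted_gibbs:
  fixes f \<phi> :: "real \<Rightarrow> real" and F :: "real \<Rightarrow> 'a :: {banach, second_countable_topology}"
  assumes f: "\<And>x. f x = f a + P (x - a)" and \<phi>: "\<And>x. \<phi> x = \<phi> a + Q (x - a)"
  shows "(LINT \<eta>|gibbs n (\<lambda>x. f x + s * \<phi> x). F (plus_fraction n \<eta>)) =
    (1 / Z n (s * sqrt n)) *\<^sub>R (\<Sum>k\<le>n. W n (s * sqrt n) k *\<^sub>R F (real k / real n))"
proof -
  define K where "K = exp (real n * (f a + s * \<phi> a))"
  have K: "K > 0" by (simp add: K_def)
  have w: "real (n choose k) * exp (real n * (f (real k / real n) + s * \<phi> (real k / real n))) = K * W n (s * sqrt n) k" for k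
  proof -
    have tilt: "s * sqrt n * X n k = real n * (s * Q (dev n k))" by (simp add: X_def)
    have pot: "f (real k / real n) + s * \<phi> (real k / real n) = (f a + s * \<phi> a) + (P (dev n k) + s * Q (dev n k))"
      using f[of "real k / real n"] \<phi>[of "real k / real n"] by (simp add: dev_def algebra_simps)
    have "exp (real n * (f (real k / real n) + s * \<phi> (real k / real n))) =
      K * exp (real n * P (dev n k) + s * sqrt n * X n k)"
      unfolding tilt pot K_def exp_add[symmetric] by (simp only: distrib_left)
    then show ?thesis unfolding W_def by (simp add: mult_ac)
  qed
  let ?S = "\<Sum>k\<le>n. W n (s * sqrt n) k *\<^sub>R F (real k / real n)"
  have "(\<Sum>k\<le>n. (K * W n (s * sqrt n) k) *\<^sub>R F (real k / real n)) = K *\<^sub>R ?S"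
    by (simp add: scaleR_sum_right)
  moreover have "(\<Sum>k\<le>n. K * W n (s * sqrt n) k) = K * Z n (s * sqrt n)"
    by (simp add: Z_def sum_distrib_left)
  ultimately show ?thesis unfolding integral_gibbs w using K by simp
qed

text \<open>Here \<open>f\<close> is the true potential and \<open>U\<close> the unscaled estimation
  error. The number \<open>r\<close> is a distance within which the parameter can be lowered without
  leaving its range, so \<open>U\<close> has to solve the equation only if some admissible shift
  does. Condition \<open>inj\<close> makes the statistic nonconstant, hence the tilted mean strictly
  increasing.\<close>

lemma gibbs_estimator_clt:
  fixes f \<phi> :: "real \<Rightarrow> real" and U :: "nat \<Rightarrow> (nat \<Rightarrow> real) \<Rightarrow> real"
  assumes f: "\<And>x. f x = f a + P (x - a)" and \<phi>: "\<And>x. \<phi> x = \<phi> a + Q (x - a)"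
    and d1: "d1 \<noteq> 0"
    and inj: "eventually (\<lambda>n. \<phi> 0 \<noteq> \<phi> (1 / real n)) sequentially"
    and r: "r > 0"
    and U: "\<And>n \<omega> s. \<omega> \<in> configs n \<Longrightarrow> s > - r \<Longrightarrow>
       (LINT \<eta>|gibbs n (\<lambda>x. f x + s * \<phi> x). \<phi> (plus_fraction n \<eta>)) = \<phi> (plus_fraction n \<omega>) \<Longrightarrow>
       (LINT \<eta>|gibbs n (\<lambda>x. f x + U n \<omega> * \<phi> x). \<phi> (plus_fraction n \<eta>)) = \<phi> (plus_fraction n \<omega>)"
  shows "weak_conv_m (\<lambda>n. distr (gibbs n f) borel (\<lambda>\<omega>. sqrt n * U n \<omega>)) (centered_normal (1 / v))"
proof -
  have v: "v > 0" using d1 kappa_pos by (simp add: v_def)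
  define Y where "Y n \<omega> = sqrt n * (\<phi> (plus_fraction n \<omega>) - \<phi> a)" for n \<omega>
  have X: "sqrt n * (\<phi> (real k / real n) - \<phi> a) = X n k" for n k
    using \<phi>[of "real k / real n"] by (simp add: X_def dev_def)
  have eq_iff: "(LINT \<eta>|gibbs n (\<lambda>x. f x + s * \<phi> x). \<phi> (plus_fraction n \<eta>)) = \<phi> (plus_fraction n \<omega>) \<longleftrightarrow>
      mean n (s * sqrt n) = Y n \<omega>" if n: "n > 0" for n s \<omega>
  proof -
    let ?t = "s * sqrt n"
    have "\<phi> (real k / real n) = \<phi> a + X n k / sqrt n" for k
      using n X[of n k] by (simp add: field_simps)
    then have "(LINT \<eta>|gibbs n (\<lambda>x. f x + s * \<phi> x). \<phi> (plus_fraction n \<eta>)) =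
      (1 / Z n ?t) * (\<Sum>k\<le>n. W n ?t k * (\<phi> a + X n k / sqrt n))"
      using integral_tilted_gibbs[where f = f and \<phi> = \<phi>, OF f \<phi>, of n s \<phi>] by simp
    also have "(\<Sum>k\<le>n. W n ?t k * (\<phi> a + X n k / sqrt n)) = Z n ?t * \<phi> a + (\<Sum>k\<le>n. W n ?t k * X n k) / sqrt n"
      by (simp add: distrib_left sum.distrib Z_def sum_distrib_right sum_divide_distrib)
    also have "(1 / Z n ?t) * \<dots> = \<phi> a + mean n ?t / sqrt n"
      using Z_pos[of n ?t] by (simp add: mean_def field_simps)
    finally have "sqrt n * ((LINT \<eta>|gibbs n (\<lambda>x. f x + s * \<phi> x). \<phi> (plus_fraction n \<eta>)) - \<phi> a) = mean n ?t"
      using n by simp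
    then show ?thesis using n unfolding Y_def by auto
  qed
  show ?thesis
  proof (rule weak_conv_inverse_estimator[where X = Y and m = mean, OF prob_space_gibbs measurable_gibbs measurable_gibbs v _ mean_tendsto _ continuous_mean])
    show "weak_conv_m (\<lambda>n. distr (gibbs n f) borel (\<lambda>\<omega>. Y n \<omega> / sqrt v)) std_normal_distribution"
    proof (rule levy_continuity)
      show "real_distribution (distr (gibbs n f) borel (\<lambda>\<omega>. Y n \<omega> / sqrt v))" for n
        by (rule prob_space.real_distribution_distr[OF prob_space_gibbs measurable_gibbs])
      show "real_distribution std_normal_distribution" by (rule real_dist_normal_dist)
      fix s :: real
      have "char (distr (gibbs n f) borel (\<lambda>\<omega>. Y n \<omega> / sqrt v)) s =
        (\<Sum>k\<le>n. V n (\<i> * of_real (s / sqrt v)) k) / of_real (Z n 0)" for n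
      proof -
        have "char (distr (gibbs n f) borel (\<lambda>\<omega>. Y n \<omega> / sqrt v)) s =
          (LINT \<eta>|gibbs n f. iexp (s * (Y n \<eta> / sqrt v)))"
          unfolding char_def by (subst integral_distr) (auto intro: measurable_gibbs)
        \<comment> \<open>At \<open>s = 0\<close> the tilted measure is \<open>gibbs n f\<close>
          itself.\<close>
        also have "\<dots> = (1 / Z n 0) *\<^sub>R (\<Sum>k\<le>n. W n 0 k *\<^sub>R iexp (s * (X n k / sqrt v)))"
          using integral_tilted_gibbs[where f = f and \<phi> = \<phi>, OF f \<phi>, of n 0 "\<lambda>x. iexp (s * (sqrt n * (\<phi> x - \<phi> a) / sqrt v))"]
          unfolding X by (simp add: Y_def)
        also have "(\<Sum>k\<le>n. W n 0 k *\<^sub>R iexp (s * (X n k / sqrt v))) = (\<Sum>k\<le>n. V n (\<i> * of_real (s / sqrt v)) k)"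
          by (simp add: V_def W_def scaleR_conv_of_real exp_of_real[symmetric] exp_add algebra_simps)
        finally show ?thesis by (simp add: scaleR_conv_of_real)
      qed
      moreover have "v * (s / sqrt v)\<^sup>2 / 2 = s\<^sup>2 / 2" using v by (simp add: power_divide)
      ultimately show "(\<lambda>n. char (distr (gibbs n f) borel (\<lambda>\<omega>. Y n \<omega> / sqrt v)) s) \<longlonglongrightarrow> char std_normal_distribution s"
        using charfun_tendsto[of "s / sqrt v"] by (simp add: char_std_normal_distribution)
    qed
    show "eventually (\<lambda>n. strict_mono (mean n)) sequentially"
      using inj eventually_gt_at_top[of 0]
    proof eventually_elim
      case (elim n)
      then have "X n 0 \<noteq> X n 1" unfolding X[symmetric] by simp
      then show ?case using elim(2) by (intro strict_mono_mean[of 0 _ 1]) auto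
    qed
    fix R :: real assume R: "R > 0"
    \<comment> \<open>Tilts up to \<open>R\<close> are parameter shifts of size at most
      \<open>R / sqrt n\<close>, which eventually stay inside the admissible range.\<close>
    have "(\<lambda>n. R / sqrt (real n)) \<longlonglongrightarrow> 0" by real_asymp
    then have "eventually (\<lambda>n. R / sqrt (real n) < r) sequentially" using r by (rule order_tendstoD)
    then show "eventually (\<lambda>n. \<forall>\<omega>\<in>space (gibbs n f). \<forall>s. \<bar>s\<bar> \<le> R \<longrightarrow> mean n s = Y n \<omega> \<longrightarrow>
        mean n (sqrt n * U n \<omega>) = Y n \<omega>) sequentially"
      using eventually_gt_at_top[of 0]
    proof eventually_elim
      case (elim n)
      show ?case
      proof (intro ballI allI impI)
        fix \<omega> s assume w: "\<omega> \<in> space (gibbs n f)" and s: "\<bar>s\<bar> \<le> R" "mean n s = Y n \<omega>"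
        have "- s / sqrt n \<le> R / sqrt n" using s by (intro divide_right_mono) auto
        then have "s / sqrt n > - r" using elim(1) by simp
        moreover have "mean n (s / sqrt n * sqrt n) = Y n \<omega>" using s elim(2) by simp
        ultimately have "mean n (U n \<omega> * sqrt n) = Y n \<omega>"
          using U[of \<omega> n "s / sqrt n"] w unfolding eq_iff[OF elim(2)] space_gibbs by simp
        then show "mean n (sqrt n * U n \<omega>) = Y n \<omega>" by (simp add: mult.commute)
      qed
    qed
  qed
qed

end

section \<open>Quadratic decay at a regular maximizer\<close>

text \<open>The value \<open>0 * ln 0 = 0\<close> is the limit of \<open>x * ln x\<close> at 0; the
  other summand follows by reflecting \<open>x\<close> to \<open>1 - x\<close>.\<close>

lemma continuous_on_entropy_I: "continuous_on {0..1} entropy_I"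
proof -
  have xlnx: "continuous_on {0..1} (\<lambda>x::real. x * ln x)"
  proof (rule continuous_on_eq_continuous_within[THEN iffD2], intro ballI)
    fix x :: real assume x: "x \<in> {0..1}"
    show "continuous (at x within {0..1}) (\<lambda>x. x * ln x)"
    proof (cases "x = 0")
      case True
      have "((\<lambda>x::real. x * ln x) \<longlongrightarrow> 0) (at_right 0)" by real_asymp
      then show ?thesis using True by (simp add: continuous_within at_within_Icc_at_right)
    qed (use x in \<open>auto intro!: continuous_intros\<close>)
  qed
  have "continuous_on {0..1} (\<lambda>x::real. (1 - x) * ln (1 - x))"
    by (rule continuous_on_compose2[OF xlnx, of _ "\<lambda>x. 1 - x"]) (auto intro!: continuous_intros)
  from continuous_on_diff[OF continuous_on_minus[OF xlnx] this] show ?thesis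
    by (simp add: entropy_I_def[abs_def])
qed

lemma cubic_A_has_derivs:
  assumes "0 < x" "x < 1"
  shows "(cubic_A \<beta> h has_real_derivative 6 * \<beta> * (2 * x - 1)\<^sup>2 + 4 * h * (2 * x - 1) + ln (1 - x) - ln x) (at x)"
    and "((\<lambda>x. 6 * \<beta> * (2 * x - 1)\<^sup>2 + 4 * h * (2 * x - 1) + ln (1 - x) - ln x) has_real_derivative
        24 * \<beta> * (2 * x - 1) + 8 * h - 1 / (x * (1 - x))) (at x)"
proof -
  have "(cubic_f \<beta> h has_real_derivative 6 * \<beta> * (2 * x - 1)\<^sup>2 + 4 * h * (2 * x - 1)) (at x)"
    unfolding cubic_f_def[abs_def] by (auto intro!: derivative_eq_intros simp: power2_eq_square)
  moreover have "(entropy_I has_real_derivative ln (1 - x) - ln x) (at x)"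
    unfolding entropy_I_def[abs_def] using assms by (auto intro!: derivative_eq_intros)
  ultimately have "((\<lambda>x. cubic_f \<beta> h x + entropy_I x) has_real_derivative
      6 * \<beta> * (2 * x - 1)\<^sup>2 + 4 * h * (2 * x - 1) + (ln (1 - x) - ln x)) (at x)" by (rule DERIV_add)
  then show "(cubic_A \<beta> h has_real_derivative 6 * \<beta> * (2 * x - 1)\<^sup>2 + 4 * h * (2 * x - 1) + ln (1 - x) - ln x) (at x)"
    by (simp add: cubic_A_def[abs_def] add_diff_eq)
  have "1 / (x * (1 - x)) = 1 / (1 - x) + 1 / x" using assms by (simp add: field_simps)
  then show "((\<lambda>x. 6 * \<beta> * (2 * x - 1)\<^sup>2 + 4 * h * (2 * x - 1) + ln (1 - x) - ln x) has_real_derivative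
      24 * \<beta> * (2 * x - 1) + 8 * h - 1 / (x * (1 - x))) (at x)"
    using assms by (auto intro!: derivative_eq_intros)
qed

lemma
  assumes a: "0 < a" "a < 1"
  shows deriv_cubic_A: "deriv (cubic_A \<beta> h) a = 6 * \<beta> * (2 * a - 1)\<^sup>2 + 4 * h * (2 * a - 1) + ln (1 - a) - ln a"
    and deriv2_cubic_A: "deriv (deriv (cubic_A \<beta> h)) a = 24 * \<beta> * (2 * a - 1) + 8 * h - 1 / (a * (1 - a))"
proof -
  let ?D = "\<lambda>x. 6 * \<beta> * (2 * x - 1)\<^sup>2 + 4 * h * (2 * x - 1) + ln (1 - x) - ln x"
  show "deriv (cubic_A \<beta> h) a = ?D a" by (rule DERIV_imp_deriv[OF cubic_A_has_derivs(1)[OF a]])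
  have "eventually (\<lambda>x. x \<in> {0<..<1}) (nhds a)" using a by (intro eventually_nhds_in_open) auto
  then have "eventually (\<lambda>x. deriv (cubic_A \<beta> h) x = ?D x) (nhds a)"
    by eventually_elim (auto intro!: DERIV_imp_deriv cubic_A_has_derivs(1))
  then have "(deriv (cubic_A \<beta> h) has_real_derivative 24 * \<beta> * (2 * a - 1) + 8 * h - 1 / (a * (1 - a))) (at a)"
    using cubic_A_has_derivs(2)[OF a] by (subst DERIV_cong_ev) (auto simp: eq_commute)
  then show "deriv (deriv (cubic_A \<beta> h)) a = 24 * \<beta> * (2 * a - 1) + 8 * h - 1 / (a * (1 - a))"
    by (rule DERIV_imp_deriv)
qed

text \<open>Taking \<open>l / 4\<close> instead of the Taylor coefficient \<open>l / 2\<close>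
  leaves slack: after subtracting the parabola, the derivative still has slope
  \<open>l / 2 < 0\<close> at \<open>a\<close>, so it changes sign from plus to minus there.
  Differentiability of \<open>f'\<close> at \<open>a\<close> alone is enough for this.\<close>

lemma strict_local_max_quadratic:
  fixes f :: "real \<Rightarrow> real"
  assumes "\<delta> > 0" and f: "\<And>x. \<bar>x - a\<bar> < \<delta> \<Longrightarrow> (f has_real_derivative f' x) (at x)"
    and f': "(f' has_real_derivative l) (at a)" "f' a = 0" "l < 0"
  obtains \<epsilon> where "\<epsilon> > 0" "\<And>x. \<bar>x - a\<bar> < \<epsilon> \<Longrightarrow> f x \<le> f a + l / 4 * (x - a)\<^sup>2"
proof -
  define g where "g x = f x - l / 4 * (x - a)\<^sup>2" for x
  define g' where "g' x = f' x - l / 2 * (x - a)" for x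
  have g: "(g has_real_derivative g' x) (at x)" if "\<bar>x - a\<bar> < \<delta>" for x
    unfolding g_def g'_def by (auto intro!: derivative_eq_intros f[OF that])
  have g': "(g' has_real_derivative l / 2) (at a)"
    unfolding g'_def by (auto intro!: derivative_eq_intros f')
  have g'0: "g' a = 0" by (simp add: g'_def f')
  from DERIV_neg_dec_right[OF g'] f'(3) obtain d1 where d1: "d1 > 0" "\<And>h. 0 < h \<Longrightarrow> h < d1 \<Longrightarrow> g' (a + h) < 0"
    using g'0 by auto
  from DERIV_neg_dec_left[OF g'] f'(3) obtain d2 where d2: "d2 > 0" "\<And>h. 0 < h \<Longrightarrow> h < d2 \<Longrightarrow> g' (a - h) > 0"
    using g'0 by auto
  define \<epsilon> where "\<epsilon> = min \<delta> (min d1 d2)"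
  have "g x \<le> g a" if x: "\<bar>x - a\<bar> < \<epsilon>" for x
  proof (cases "x \<ge> a")
    case True
    have "g' y \<le> 0" if "a \<le> y" "y \<le> x" for y
      using d1(2)[of "y - a"] that x g'0 by (cases "y = a") (auto simp: \<epsilon>_def)
    then have "\<exists>z. (g has_real_derivative z) (at y) \<and> z \<le> 0" if "a \<le> y" "y \<le> x" for y
      using that x by (intro exI[of _ "g' y"] conjI g) (auto simp: \<epsilon>_def)
    with True show ?thesis by (rule DERIV_nonpos_imp_nonincreasing)
  next
    case False
    have "g' y \<ge> 0" if "x \<le> y" "y \<le> a" for y
      using d2(2)[of "a - y"] that x g'0 by (cases "y = a") (auto simp: \<epsilon>_def)
    then have "\<exists>z. (g has_real_derivative z) (at y) \<and> z \<ge> 0" if "x \<le> y" "y \<le> a" for y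
      using that x by (intro exI[of _ "g' y"] conjI g) (auto simp: \<epsilon>_def)
    moreover have "x \<le> a" using False by simp
    ultimately show ?thesis using DERIV_nonneg_imp_nondecreasing[of x a g] by blast
  qed
  then have "\<And>x. \<bar>x - a\<bar> < \<epsilon> \<Longrightarrow> f x \<le> f a + l / 4 * (x - a)\<^sup>2" unfolding g_def by fastforce
  moreover have "\<epsilon> > 0" using assms(1) d1(1) d2(1) by (simp add: \<epsilon>_def)
  ultimately show ?thesis using that by blast
qed

text \<open>Near \<open>a\<close> the second derivative gives the bound. Away from \<open>a\<close>,
  compactness and uniqueness of the maximizer give a gap \<open>m\<close>, which dominates a small
  multiple of \<open>(x - a)\<^sup>2\<close> because
  \<open>\<bar>x - a\<bar> \<le> 1\<close>.\<close>

lemma cubic_A_quadratic_bound: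
  assumes max: "A_maximizers \<beta> h = {a}" and reg: "two_regular \<beta> h a" and a: "0 < a" "a < 1"
  obtains c where "c > 0" "\<And>x. 0 \<le> x \<Longrightarrow> x \<le> 1 \<Longrightarrow> cubic_A \<beta> h x \<le> cubic_A \<beta> h a - c * (x - a)\<^sup>2"
proof -
  let ?A = "cubic_A \<beta> h"
  define l where "l = 24 * \<beta> * (2 * a - 1) + 8 * h - 1 / (a * (1 - a))"
  have l: "l < 0" using reg unfolding two_regular_def deriv2_cubic_A[OF a] l_def by simp
  have d0: "6 * \<beta> * (2 * a - 1)\<^sup>2 + 4 * h * (2 * a - 1) + ln (1 - a) - ln a = 0"
    using reg unfolding two_regular_def deriv_cubic_A[OF a] by simp
  have "min a (1 - a) > 0" using a by simp
  then obtain \<epsilon> where e: "\<epsilon> > 0" "\<And>x. \<bar>x - a\<bar> < \<epsilon> \<Longrightarrow> ?A x \<le> ?A a + l / 4 * (x - a)\<^sup>2"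
  proof (rule strict_local_max_quadratic[where f = ?A and a = a and l = l
      and f' = "\<lambda>x. 6 * \<beta> * (2 * x - 1)\<^sup>2 + 4 * h * (2 * x - 1) + ln (1 - x) - ln x"])
    show "(?A has_real_derivative 6 * \<beta> * (2 * x - 1)\<^sup>2 + 4 * h * (2 * x - 1) + ln (1 - x) - ln x) (at x)"
      if "\<bar>x - a\<bar> < min a (1 - a)" for x using that by (intro cubic_A_has_derivs) auto
    show "((\<lambda>x. 6 * \<beta> * (2 * x - 1)\<^sup>2 + 4 * h * (2 * x - 1) + ln (1 - x) - ln x) has_real_derivative l) (at a)"
      unfolding l_def by (rule cubic_A_has_derivs(2)[OF a])
  qed (use d0 l in auto)
  define K where "K = {0..1} \<inter> {x. \<epsilon> \<le> \<bar>x - a\<bar>}"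
  have K: "compact K" unfolding K_def by (intro compact_Int_closed closed_Collect_le continuous_intros) auto
  have cont: "continuous_on K ?A"
  proof -
    have "continuous_on {0..1} ?A"
      unfolding cubic_A_def[abs_def] cubic_f_def by (intro continuous_intros continuous_on_entropy_I)
    then show ?thesis by (rule continuous_on_subset) (auto simp: K_def)
  qed
  have less: "?A x < ?A a" if "x \<in> K" for x
  proof -
    have "x \<notin> A_maximizers \<beta> h" "a \<in> A_maximizers \<beta> h" using that e(1) max by (auto simp: K_def)
    then show ?thesis using that by (force simp: A_maximizers_def is_arg_max_def K_def not_less)
  qed
  obtain m where m: "m > 0" "\<And>x. x \<in> K \<Longrightarrow> ?A x \<le> ?A a - m"
  proof (cases "K = {}")
    case False
    from continuous_attains_sup[OF K this cont] obtain x0 where x0: "x0 \<in> K" "\<And>x. x \<in> K \<Longrightarrow> ?A x \<le> ?A x0" by blast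
    then show ?thesis using less[of x0] by (intro that[of "?A a - ?A x0"]) auto
  qed (use that[of 1] in auto)
  define c where "c = min m (- l / 4)"
  have "?A x \<le> ?A a - c * (x - a)\<^sup>2" if x: "0 \<le> x" "x \<le> 1" for x
  proof (cases "\<bar>x - a\<bar> < \<epsilon>")
    case True
    have "c * (x - a)\<^sup>2 \<le> (- l / 4) * (x - a)\<^sup>2" by (intro mult_right_mono) (auto simp: c_def)
    then show ?thesis using e(2)[OF True] by linarith
  next
    case False
    have "\<bar>x - a\<bar> \<le> 1" using x a by auto
    then have "(x - a)\<^sup>2 \<le> 1" by (simp add: abs_square_le_1)
    then have "c * (x - a)\<^sup>2 \<le> m * 1" using m(1) by (intro mult_mono) (auto simp: c_def)
    then show ?thesis using m(2)[of x] False x by (auto simp: K_def)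
  qed
  moreover have "c > 0" using m(1) l by (simp add: c_def)
  ultimately show ?thesis using that by blast
qed

section \<open>The cube and the square of \<open>2 * x - 1\<close> as statistics\<close>

theorem theorem5p4:
  fixes \<beta> h :: real and g :: "real \<Rightarrow> real"
  assumes "phase_diagram g"
    and "(\<beta>, h) \<in> ({0<..} \<times> UNIV) - phase_curve g"
    and "1/2 \<notin> A_maximizers \<beta> h"
  shows "\<exists>\<sigma>\<^sub>\<beta> > 0. \<exists>\<sigma>\<^sub>h > 0. \<forall>\<beta>hat hhat.
    is_beta_MLE h \<beta>hat \<longrightarrow> is_h_MLE \<beta> hhat \<longrightarrow>
      weak_conv_m (scaled_error_law \<beta>hat \<beta> \<beta> h) (centered_normal \<sigma>\<^sub>\<beta>) \<and>
      weak_conv_m (scaled_error_law hhat h \<beta> h) (centered_normal \<sigma>\<^sub>h)"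
proof -
  obtain a where a: "0 < a" "a < 1" and max: "A_maximizers \<beta> h = {a}" and reg: "two_regular \<beta> h a"
    using assms(1,2) unfolding phase_diagram_def by blast
  have \<beta>: "\<beta> > 0" using assms(2) by auto
  \<comment> \<open>Since \<open>a\<close> differs from 1/2, \<open>b\<close> is nonzero, and with
    it the slopes \<open>6 * b\<^sup>2\<close> and \<open>4 * b\<close> of the two statistics at
    \<open>a\<close>; this makes both limiting variances of the statistics positive.\<close>
  define b where "b = 2 * a - 1"
  have b: "b \<noteq> 0" using assms(3) max by (auto simp: b_def)
  from cubic_A_quadratic_bound[OF max reg a] obtain c where c: "c > 0"
    "\<And>x. 0 \<le> x \<Longrightarrow> x \<le> 1 \<Longrightarrow> cubic_A \<beta> h x \<le> cubic_A \<beta> h a - c * (x - a)\<^sup>2" by blast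
  define c1 where "c1 = 6 * \<beta> * b\<^sup>2 + 4 * h * b"
  define c2 where "c2 = 12 * \<beta> * b + 4 * h"
  define c3 where "c3 = 8 * \<beta>"
  have taylor: "cubic_f \<beta> h x = cubic_f \<beta> h a + (c1 * (x - a) + c2 * (x - a)\<^sup>2 + c3 * (x - a) ^ 3)" for x
    by (simp add: cubic_f_def c1_def c2_def c3_def b_def power2_eq_square power3_eq_cube algebra_simps)
  have c1: "c1 = ln a - ln (1 - a)"
    using reg unfolding two_regular_def deriv_cubic_A[OF a] c1_def b_def by simp
  have c2: "2 * c2 < 1 / (a * (1 - a))"
    using reg unfolding two_regular_def deriv2_cubic_A[OF a] c2_def b_def by simp
  have dom: "c1 * (x - a) + c2 * (x - a)\<^sup>2 + c3 * (x - a) ^ 3 + entropy_I x \<le> entropy_I a - c * (x - a)\<^sup>2"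
    if "0 \<le> x" "x \<le> 1" for x using c(2)[OF that] taylor[of x] by (simp add: cubic_A_def)
  \<comment> \<open>The statistics expand at \<open>a\<close>, with \<open>y = x - a\<close>, as
    \<open>(b + 2 * y) ^ 3\<close> and \<open>(b + 2 * y)\<^sup>2\<close>, which gives the
    coefficients \<open>6 * b\<^sup>2, 12 * b, 8\<close> and \<open>4 * b, 4, 0\<close>.\<close>
  interpret B: cubic_laplace a c1 c2 c3 "6 * b\<^sup>2" "12 * b" 8 c
    by unfold_locales (use a c1 c2 c(1) dom in auto)
  interpret H: cubic_laplace a c1 c2 c3 "4 * b" 4 0 c
    by unfold_locales (use a c1 c2 c(1) dom in auto)
  have Bv: "B.v > 0" and Hv: "H.v > 0" using b B.kappa_pos H.kappa_pos by (auto simp: B.v_def H.v_def)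
  have "weak_conv_m (scaled_error_law T \<beta> \<beta> h) (centered_normal (1 / B.v))" if T: "is_beta_MLE h T" for T
  proof -
    have "weak_conv_m (\<lambda>n. distr (gibbs n (cubic_f \<beta> h)) borel (\<lambda>\<omega>. sqrt n * (T n \<omega> - \<beta>))) (centered_normal (1 / B.v))"
    \<comment> \<open>The admissible radius is \<open>r = \<beta>\<close>: a shift
      \<open>s > - \<beta>\<close> keeps the parameter positive, as \<open>is_beta_MLE\<close>
      demands of a solution.\<close>
    proof (rule B.gibbs_estimator_clt[where \<phi> = "\<lambda>x. (2 * x - 1) ^ 3", OF _ _ _ _ \<beta>])
      show "cubic_f \<beta> h x = cubic_f \<beta> h a + B.P (x - a)" for x using taylor[of x] by (simp add: B.P_def)
      show "(2 * x - 1) ^ 3 = (2 * a - 1) ^ 3 + B.Q (x - a)" for x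
        unfolding B.Q_def by (simp add: b_def power2_eq_square power3_eq_cube algebra_simps)
      show "6 * b\<^sup>2 \<noteq> 0" using b by simp
      show "eventually (\<lambda>n. (2 * 0 - 1) ^ 3 \<noteq> (2 * (1 / real n) - 1) ^ 3) sequentially"
        using eventually_gt_at_top[of 0]
      proof eventually_elim
        case (elim n)
        define y where "y = 1 / real n"
        \<comment> \<open>With \<open>u = 2 * y - 1\<close> this is
          \<open>u ^ 3 + 1 = (u + 1) * (u\<^sup>2 - u + 1)\<close>, the second factor being written
          as a square plus 3/4.\<close>
        have "(2 * y - 1) ^ 3 - (2 * 0 - 1) ^ 3 = 2 * y * ((2 * y - 3 / 2)\<^sup>2 + 3 / 4)"
          by (simp add: power2_eq_square power3_eq_cube field_simps)
        also have "\<dots> > 0" using elim by (intro mult_pos_pos add_nonneg_pos) (auto simp: y_def)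
        finally show ?case unfolding y_def by linarith
      qed
      have shift: "cubic_measure n (\<beta> + s) h = gibbs n (\<lambda>x. cubic_f \<beta> h x + s * (2 * x - 1) ^ 3)" for n s
        unfolding cubic_measure_gibbs
        by (rule arg_cong[where f = "gibbs n"]) (simp add: fun_eq_iff cubic_f_def distrib_right)
      fix n \<omega> s assume w: "\<omega> \<in> configs n" "s > - \<beta>"
        and e: "(LINT \<eta>|gibbs n (\<lambda>x. cubic_f \<beta> h x + s * (2 * x - 1) ^ 3). (2 * plus_fraction n \<eta> - 1) ^ 3) = (2 * plus_fraction n \<omega> - 1) ^ 3"
      from e have "beta_equation n h \<omega> (\<beta> + s)" unfolding beta_equation_def shift .
      moreover have "\<beta> + s > 0" using w by simp
      ultimately have "beta_equation n h \<omega> (T n \<omega>)" using T w(1) unfolding is_beta_MLE_def by blast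
      then show "(LINT \<eta>|gibbs n (\<lambda>x. cubic_f \<beta> h x + (T n \<omega> - \<beta>) * (2 * x - 1) ^ 3). (2 * plus_fraction n \<eta> - 1) ^ 3) = (2 * plus_fraction n \<omega> - 1) ^ 3"
        unfolding shift[symmetric] beta_equation_def by simp
    qed
    then show ?thesis by (simp add: scaled_error_law_def[abs_def] cubic_measure_gibbs)
  qed
  moreover have "weak_conv_m (scaled_error_law T h \<beta> h) (centered_normal (1 / H.v))" if T: "is_h_MLE \<beta> T" for T
  proof -
    have "weak_conv_m (\<lambda>n. distr (gibbs n (cubic_f \<beta> h)) borel (\<lambda>\<omega>. sqrt n * (T n \<omega> - h))) (centered_normal (1 / H.v))"
    \<comment> \<open>Every real \<open>h\<close> is admissible, so the radius may be any positive
      number; it is set to 1.\<close>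
    proof (rule H.gibbs_estimator_clt[where \<phi> = "\<lambda>x. (2 * x - 1)\<^sup>2", OF _ _ _ _ zero_less_one])
      show "cubic_f \<beta> h x = cubic_f \<beta> h a + H.P (x - a)" for x using taylor[of x] by (simp add: H.P_def)
      show "(2 * x - 1)\<^sup>2 = (2 * a - 1)\<^sup>2 + H.Q (x - a)" for x
        unfolding H.Q_def by (simp add: b_def power2_eq_square algebra_simps)
      show "4 * b \<noteq> 0" using b by simp
      \<comment> \<open>The case \<open>n = 1\<close> has to be excluded, since both squares are
        then 1.\<close>
      show "eventually (\<lambda>n. (2 * 0 - 1)\<^sup>2 \<noteq> (2 * (1 / real n) - 1)\<^sup>2) sequentially"
        using eventually_gt_at_top[of 1] by eventually_elim (simp add: power2_eq_square field_simps)
      have shift: "cubic_measure n \<beta> (h + s) = gibbs n (\<lambda>x. cubic_f \<beta> h x + s * (2 * x - 1)\<^sup>2)" for n s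
        unfolding cubic_measure_gibbs
        by (rule arg_cong[where f = "gibbs n"]) (simp add: fun_eq_iff cubic_f_def distrib_right)
      fix n \<omega> s assume w: "\<omega> \<in> configs n"
        and e: "(LINT \<eta>|gibbs n (\<lambda>x. cubic_f \<beta> h x + s * (2 * x - 1)\<^sup>2). (2 * plus_fraction n \<eta> - 1)\<^sup>2) = (2 * plus_fraction n \<omega> - 1)\<^sup>2"
      from e have "h_equation n \<beta> \<omega> (h + s)" unfolding h_equation_def shift .
      then have "h_equation n \<beta> \<omega> (T n \<omega>)" using T w unfolding is_h_MLE_def by blast
      then show "(LINT \<eta>|gibbs n (\<lambda>x. cubic_f \<beta> h x + (T n \<omega> - h) * (2 * x - 1)\<^sup>2). (2 * plus_fraction n \<eta> - 1)\<^sup>2) = (2 * plus_fraction n \<omega> - 1)\<^sup>2"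
        unfolding shift[symmetric] h_equation_def by simp
    qed
    then show ?thesis by (simp add: scaled_error_law_def[abs_def] cubic_measure_gibbs)
  qed
  moreover have "1 / B.v > 0" "1 / H.v > 0" using Bv Hv by auto
  ultimately show ?thesis by blast
qed

end
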